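(* Let $k\in\mathbb{N}$ and $z\in\mathbb{C}$ with $-1<\operatorname{Re}(z)<k$. As $y\to\infty$ through positive reals, \[ H_z^{(k)}(y)\sim\frac{\sqrt{\pi}\,\Big(\frac14\big(\frac{y}{2k}\big)^{2k}\Big)^{\frac{1}{4(k+1)}-\frac{1+z}{2k(k+1)}}}{\sqrt{k(k+1)}\,2^{\frac{1+z}{k}}}\cos\!\left(\frac{\pi}{4}+(2k+2)\Big(\frac14\Big(\frac{y}{2k}\Big)^{2k}\Big)^{\frac{1}{2k+2}}\right). \]
   Context: $H_z^{(k)}(x):=\int_0^\infty t^{z-k}\cos(xt)\cos(t^{-k})\,dt$ for $x>0$.
   Formalization: "∼" is proved as H = A·(cos θ + o(1)), A being the factor before the cosine; the quotient does not tend to 1 in general, since for k=1, z=0, H = K_0(2√y) − (π/2)Y_0(2√y) is nonzero at all large zeros of the cosine. *)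

theory Defs
  imports "HOL-Analysis.Analysis" "HOL-Library.Landau_Symbols"
begin

(* The integral over (0,\<infinity>) is in general only conditionally convergent, both at 0 and at
   infinity, so it is the two-sided improper integral: the limit, as a tends to 0 from the right
   and b tends to infinity independently, of the integral over [a,b].  A Lebesgue integral over
   (0,\<infinity>) would be the wrong reading. *)

definition H_integrand :: "nat \<Rightarrow> complex \<Rightarrow> real \<Rightarrow> real \<Rightarrow> complex" where
  "H_integrand k z x t =
     complex_of_real t powr (z - of_nat k) * of_real (cos (x * t)) * of_real (cos (1 / t ^ k))"

definition H :: "nat \<Rightarrow> complex \<Rightarrow> real \<Rightarrow> complex" where
  "H k z x = Lim (at_right 0 \<times>\<^sub>F at_top) (\<lambda>(a, b). integral {a..b} (H_integrand k z x))"

definition scale_var :: "nat \<Rightarrow> real \<Rightarrow> real" where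
  "scale_var k y = 1 / 4 * (y / (2 * real k)) ^ (2 * k)"

(* The asymptotic main term is H_amplitude k z y * cos (H_phase k y). *)

definition H_amplitude :: "nat \<Rightarrow> complex \<Rightarrow> real \<Rightarrow> complex" where
  "H_amplitude k z y =
     of_real (sqrt pi) *
     of_real (scale_var k y) powr
       (1 / (4 * (of_nat k + 1)) - (1 + z) / (2 * of_nat k * (of_nat k + 1)))
     / (of_real (sqrt (real k * (real k + 1))) * 2 powr ((1 + z) / of_nat k))"

definition H_phase :: "nat \<Rightarrow> real \<Rightarrow> real" where
  "H_phase k y = pi / 4 + (2 * real k + 2) * scale_var k y powr (1 / (2 * real k + 2))"

end

(* The substitution t = t_0 s with t_0 = (k/y)^(1/(k+1)) turns H into a power of t_0 times the integral of
   s^(z-k) cos(w k s) cos(w/s^k), where w = t_0^(-k) tends to infinity with y.  The product of the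
   cosines is the half-sum of cos(w(k s + 1/s^k)) and cos(w(k s - 1/s^k)).  Only the first phase has a
   stationary point, at s = 1.  Integrating s^(z-k) against an antiderivative of the cosine bounds
   everything outside (1-d, 1+d) by O(1/(w d)), the improper ends included.  Inside, the phase is
   replaced by its second Taylor polynomial at a cost of O(d^2 + w d^4), which leaves a Fresnel
   integral.  With d = w^(-2/5) all the errors are o(w^(-1/2)), the order of the main term. *)

theory Submission
  imports Defs "HOL-Probability.Distributions" "HOL-Real_Asymp.Real_Asymp"
begin

section \<open>Tails of oscillatory integrals\<close>

text \<open>The integrals converge only conditionally, so they are never estimated as such. The
  proof works with an antiderivative on the open half line: an improper integral is the difference
  of its limits at the two ends, and cutting at 1-d and 1+d is a telescoping sum of its values. A
  tail is controlled without integrating a norm, by a real function \<open>\<Phi>\<close> whose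
  explicit derivative dominates that of the weight; the variation of \<open>\<Phi>\<close> bounds
  the tail, and the existence of the limit comes with the bound. The two bounds on
  \<open>Re z\<close> make the boundary terms vanish, at 0 and at infinity respectively. The
  exponent -2/5 balances the two largest errors: 1/(w d) = w d^4 gives d^5 = w^(-2), and both are
  then w^(-3/5). The shift pi/4 and the factor sqrt pi come from the Fresnel integral, which is
  reached from the Gaussian one by a differential equation along a segment, without contour
  integration.\<close>

text \<open>The mean value inequality with a real majorant. Since \<open>\<Phi>'\<close> is
  nonnegative on \<open>I\<close>, \<open>\<Phi>\<close> is monotone there; the absolute value frees
  the two points from any order, so that the same bound serves at both ends of the half
  line.\<close>

lemma norm_diff_le_abs_diff:
  fixes f :: "real \<Rightarrow> 'a::real_normed_vector"
  assumes "convex I" "a \<in> I" "b \<in> I"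
    and f: "\<And>x. x \<in> I \<Longrightarrow> (f has_vector_derivative f' x) (at x)"
    and \<Phi>: "\<And>x. x \<in> I \<Longrightarrow> (\<Phi> has_real_derivative \<Phi>' x) (at x)"
    and bd: "\<And>x. x \<in> I \<Longrightarrow> norm (f' x) \<le> \<Phi>' x"
  shows "norm (f b - f a) \<le> \<bar>\<Phi> b - \<Phi> a\<bar>"
proof -
  have main: "norm (f d - f c) \<le> \<Phi> d - \<Phi> c" if "c \<in> I" "d \<in> I" "c < d" for c d
  proof -
    have sub: "x \<in> I" if "c \<le> x" "x \<le> d" for x
      using mem_is_interval_1_I[of I c d x] \<open>convex I\<close> \<open>c \<in> I\<close> \<open>d \<in> I\<close> that
      by (simp add: is_interval_convex_1)
    show ?thesis
    proof (rule differentiable_bound_general[OF \<open>c < d\<close>])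
      show "continuous_on {c..d} f"
      proof (intro continuous_at_imp_continuous_on ballI)
        fix x assume "x \<in> {c..d}"
        then show "isCont f x" by (intro has_vector_derivative_continuous[OF f] sub) auto
      qed
      show "continuous_on {c..d} \<Phi>"
      proof (intro continuous_at_imp_continuous_on ballI)
        fix x assume "x \<in> {c..d}"
        then show "isCont \<Phi> x" by (intro DERIV_isCont[OF \<Phi>] sub) auto
      qed
      fix x assume "c < x" "x < d"
      then have "x \<in> I" by (intro sub) auto
      then show "(f has_vector_derivative f' x) (at x)" "(\<Phi> has_vector_derivative \<Phi>' x) (at x)"
        "norm (f' x) \<le> \<Phi>' x"
        using f \<Phi> bd by (auto simp: has_real_derivative_iff_has_vector_derivative)
    qed
  qed
  consider "a < b" | "a = b" | "b < a" by linarith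
  then show ?thesis
  proof cases
    case 1
    then show ?thesis using main[of a b] assms(2,3) by linarith
  next
    case 3
    then show ?thesis using main[of b a] assms(2,3) by (simp add: norm_minus_commute)
  qed auto
qed

text \<open>A Cauchy criterion: the increments of \<open>R\<close> inherit smallness from those of
  the convergent \<open>\<Phi>\<close>. The filter is general in order to cover
  \<open>at_right 0\<close> and \<open>at_top\<close> alike.\<close>

lemma tendsto_of_norm_diff_le:
  fixes R :: "'b \<Rightarrow> 'a::banach" and \<Phi> :: "'b \<Rightarrow> real"
  assumes "net \<noteq> bot" and I: "eventually (\<lambda>x. x \<in> I) net"
    and bd: "\<And>x y. x \<in> I \<Longrightarrow> y \<in> I \<Longrightarrow> norm (R x - R y) \<le> \<bar>\<Phi> x - \<Phi> y\<bar>"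
    and lim: "(\<Phi> \<longlongrightarrow> L) net"
  obtains T where "(R \<longlongrightarrow> T) net"
proof -
  have "cauchy_filter (filtermap R net)"
    unfolding cauchy_filter_metric_filtermap
  proof (intro allI impI)
    fix e :: real assume "e > 0"
    then have ev: "eventually (\<lambda>x. x \<in> I \<and> dist (\<Phi> x) L < e/2) net"
      using I tendstoD[OF lim, of "e/2"] by (auto intro: eventually_conj)
    moreover have "dist (R x) (R y) < e"
      if "x \<in> I \<and> dist (\<Phi> x) L < e/2" "y \<in> I \<and> dist (\<Phi> y) L < e/2" for x y
      using bd[of x y] that unfolding dist_norm real_norm_def by linarith
    ultimately show "\<exists>P. eventually P net \<and> (\<forall>x y. P x \<and> P y \<longrightarrow> dist (R x) (R y) < e)"
      by (intro exI[of _ "\<lambda>x. x \<in> I \<and> dist (\<Phi> x) L < e/2"]) auto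
  qed
  then obtain T where "filtermap R net \<le> nhds T"
    using cauchy_filter_complete_converges[of "filtermap R net" UNIV] \<open>net \<noteq> bot\<close>
    by (auto simp: complete_UNIV filtermap_bot_iff)
  then show ?thesis
    using that by (auto simp: filterlim_def)
qed

text \<open>Integration by parts in disguise: \<^term>\<open>Q x - F x * sin (\<omega> * \<psi> x) / \<omega>\<close> has the derivative
  \<^term>\<open>- F' x * sin (\<omega> * \<psi> x) / \<omega>\<close>, which is absolutely integrable where \<^term>\<open>F\<close> has bounded
  variation.\<close>

lemma oscillatory_tail:
  fixes F F' Q :: "real \<Rightarrow> complex" and \<psi> \<psi>' \<Phi> \<Phi>' :: "real \<Rightarrow> real"
  assumes net: "net \<noteq> bot" "eventually (\<lambda>x. x \<in> I) net"
    and I: "convex I" "c \<in> I" and "\<omega> > 0"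
    and \<psi>: "\<And>x. x \<in> I \<Longrightarrow> (\<psi> has_real_derivative \<psi>' x) (at x)"
    and F: "\<And>x. x \<in> I \<Longrightarrow> (F has_vector_derivative F' x) (at x)"
    and \<Phi>: "\<And>x. x \<in> I \<Longrightarrow> (\<Phi> has_real_derivative \<Phi>' x) (at x)"
    and bd: "\<And>x. x \<in> I \<Longrightarrow> norm (F' x) \<le> \<Phi>' x"
    and Q: "\<And>x. x \<in> I \<Longrightarrow>
      (Q has_vector_derivative F x * of_real (\<psi>' x) * of_real (cos (\<omega> * \<psi> x))) (at x)"
    and limF: "(F \<longlongrightarrow> 0) net" and lim\<Phi>: "(\<Phi> \<longlongrightarrow> L) net"
  obtains T where "(Q \<longlongrightarrow> T) net" "norm (T - Q c) \<le> 2 * \<bar>L - \<Phi> c\<bar> / \<omega>"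
proof -
  define S where "S x = F x * of_real (sin (\<omega> * \<psi> x) / \<omega>)" for x
  have nS: "norm (S x) \<le> norm (F x) / \<omega>" for x
  proof -
    have "norm (S x) = norm (F x) * \<bar>sin (\<omega> * \<psi> x)\<bar> / \<omega>"
      using \<open>\<omega> > 0\<close> by (simp add: S_def norm_mult norm_divide)
    also have "\<dots> \<le> norm (F x) * 1 / \<omega>"
      using \<open>\<omega> > 0\<close> by (intro divide_right_mono mult_left_mono) auto
    finally show ?thesis by simp
  qed
  have dR: "norm ((Q x - S x) - (Q y - S y)) \<le> \<bar>\<Phi> x / \<omega> - \<Phi> y / \<omega>\<bar>" if "x \<in> I" "y \<in> I" for x y
  proof (rule norm_diff_le_abs_diff[where f = "\<lambda>x. Q x - S x" and \<Phi> = "\<lambda>x. \<Phi> x / \<omega>"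
        and f' = "\<lambda>x. - F' x * of_real (sin (\<omega> * \<psi> x) / \<omega>)" and \<Phi>' = "\<lambda>x. \<Phi>' x / \<omega>"])
    fix x assume x: "x \<in> I"
    have s: "((\<lambda>x. sin (\<omega> * \<psi> x) / \<omega>) has_real_derivative cos (\<omega> * \<psi> x) * \<psi>' x) (at x)"
      using \<open>\<omega> > 0\<close> by (auto intro!: derivative_eq_intros \<psi>[OF x])
    have "(S has_vector_derivative
        F x * of_real (cos (\<omega> * \<psi> x) * \<psi>' x) + F' x * of_real (sin (\<omega> * \<psi> x) / \<omega>)) (at x)"
      unfolding S_def
      by (intro has_vector_derivative_mult F x has_vector_derivative_of_real)
        (use s in \<open>simp add: has_real_derivative_iff_has_vector_derivative\<close>)
    from has_vector_derivative_diff[OF Q[OF x] this]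
    show "((\<lambda>x. Q x - S x) has_vector_derivative - F' x * of_real (sin (\<omega> * \<psi> x) / \<omega>)) (at x)"
      by (rule has_vector_derivative_eq_rhs) (simp add: algebra_simps)
    show "((\<lambda>x. \<Phi> x / \<omega>) has_real_derivative \<Phi>' x / \<omega>) (at x)"
      by (intro DERIV_cdivide \<Phi> x)
    have "norm (F' x) * \<bar>sin (\<omega> * \<psi> x)\<bar> / \<omega> \<le> norm (F' x) * 1 / \<omega>"
      using \<open>\<omega> > 0\<close> by (intro divide_right_mono mult_left_mono) auto
    also have "\<dots> \<le> \<Phi>' x / \<omega>"
      using bd[OF x] \<open>\<omega> > 0\<close> by (simp add: divide_right_mono)
    finally show "norm (- F' x * of_real (sin (\<omega> * \<psi> x) / \<omega>)) \<le> \<Phi>' x / \<omega>"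
      using \<open>\<omega> > 0\<close> by (simp add: norm_mult norm_divide)
  qed (use I that in auto)
  have S0: "(S \<longlongrightarrow> 0) net"
  proof (rule Lim_null_comparison)
    show "eventually (\<lambda>x. norm (S x) \<le> norm (F x) / \<omega>) net"
      using nS by simp
    show "((\<lambda>x. norm (F x) / \<omega>) \<longlongrightarrow> 0) net"
      using tendsto_divide[OF tendsto_norm[OF limF] tendsto_const[of \<omega>]] \<open>\<omega> > 0\<close> by simp
  qed
  have lim': "((\<lambda>x. \<Phi> x / \<omega>) \<longlongrightarrow> L / \<omega>) net"
    using lim\<Phi> \<open>\<omega> > 0\<close> by (intro tendsto_intros) auto
  obtain T where T: "((\<lambda>x. Q x - S x) \<longlongrightarrow> T) net"
    using tendsto_of_norm_diff_le[where R = "\<lambda>x. Q x - S x", OF net dR lim'] by blast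
  have QT: "(Q \<longlongrightarrow> T) net"
    using tendsto_add[OF T S0] by simp
  have b1: "norm (T - (Q c - S c)) \<le> \<bar>L / \<omega> - \<Phi> c / \<omega>\<bar>"
  proof (rule tendsto_le[OF net(1) tendsto_rabs[OF tendsto_diff[OF lim' tendsto_const]]
          tendsto_norm[OF tendsto_diff[OF T tendsto_const]]])
    show "\<forall>\<^sub>F x in net. norm (Q x - S x - (Q c - S c)) \<le> \<bar>\<Phi> x / \<omega> - \<Phi> c / \<omega>\<bar>"
      using net(2) by (rule eventually_mono) (rule dR[OF _ I(2)])
  qed
  \<comment> \<open>As \<open>F\<close> tends to 0, the value \<open>F c\<close> in the boundary
    term is bounded by the same variation of \<open>\<Phi>\<close> as the remaining integral. This
    is the source of the factor 2 in the conclusion.\<close>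
  have b2: "norm (0 - F c) \<le> \<bar>L - \<Phi> c\<bar>"
  proof (rule tendsto_le[OF net(1) tendsto_rabs[OF tendsto_diff[OF lim\<Phi> tendsto_const]]
          tendsto_norm[OF tendsto_diff[OF limF tendsto_const]]])
    show "\<forall>\<^sub>F x in net. norm (F x - F c) \<le> \<bar>\<Phi> x - \<Phi> c\<bar>"
      using net(2)
    proof (rule eventually_mono)
      fix x assume "x \<in> I"
      show "norm (F x - F c) \<le> \<bar>\<Phi> x - \<Phi> c\<bar>"
        by (rule norm_diff_le_abs_diff[OF I(1) I(2) \<open>x \<in> I\<close> F \<Phi> bd])
    qed
  qed
  have norm_diff_le: "norm (t - q) \<le> norm (t - (q - s)) + norm s" for t q s :: complex
    using norm_triangle_ineq4[of "t - (q - s)" s] by simp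
  have "norm (T - Q c) \<le> norm (T - (Q c - S c)) + norm (S c)"
    by (rule norm_diff_le)
  also have "\<dots> \<le> \<bar>L / \<omega> - \<Phi> c / \<omega>\<bar> + \<bar>L - \<Phi> c\<bar> / \<omega>"
  proof (rule add_mono[OF b1])
    have "norm (S c) \<le> norm (F c) / \<omega>" by (rule nS)
    also have "\<dots> \<le> \<bar>L - \<Phi> c\<bar> / \<omega>"
      using b2 \<open>\<omega> > 0\<close> by (intro divide_right_mono) auto
    finally show "norm (S c) \<le> \<bar>L - \<Phi> c\<bar> / \<omega>" .
  qed
  also have "\<dots> = 2 * \<bar>L - \<Phi> c\<bar> / \<omega>"
  proof -
    have "L / \<omega> - \<Phi> c / \<omega> = (L - \<Phi> c) / \<omega>"
      by (rule diff_divide_distrib[symmetric])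
    moreover have "\<bar>(L - \<Phi> c) / \<omega>\<bar> = \<bar>L - \<Phi> c\<bar> / \<omega>"
      using \<open>\<omega> > 0\<close> by (simp only: abs_divide abs_of_pos)
    ultimately show ?thesis by (simp only: mult_2 add_divide_distrib)
  qed
  finally show ?thesis
    by (rule that[OF QT])
qed

section \<open>Fresnel integrals\<close>

lemma tendsto_integral_gaussian:
  "((\<lambda>A. integral {0..A} (\<lambda>u. exp (- u\<^sup>2) :: real)) \<longlongrightarrow> sqrt pi / 2) at_top"
proof -
  have int: "set_integrable lborel {0..} (\<lambda>u. exp (- u\<^sup>2) :: real)"
    using gaussian_moment_0 by (simp add: set_integrable_def has_bochner_integral_iff)
  have val: "set_lebesgue_integral lborel {0..} (\<lambda>u. exp (- u\<^sup>2) :: real) = sqrt pi / 2"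
    using gaussian_moment_0 by (simp add: set_lebesgue_integral_def has_bochner_integral_iff)
  have "set_lebesgue_integral lborel {0..A} (\<lambda>u. exp (- u\<^sup>2) :: real) =
      integral {0..A} (\<lambda>u. exp (- u\<^sup>2))" for A :: real
    by (intro set_borel_integral_eq_integral(2) set_integrable_subset[OF int]) auto
  then show ?thesis
    using tendsto_set_lebesgue_integral_at_top[OF _ int] val by simp
qed

text \<open>The integral of \<^term>\<open>exp (- w * u\<^sup>2)\<close> over \<^term>\<open>{0..A}\<close>, multiplied by the square root of
  \<^term>\<open>w\<close>, is almost constant along the segment from \<^term>\<open>-\<i>\<close> to \<^term>\<open>1\<close>: integrating the
  derivative by parts leaves only a boundary term at \<^term>\<open>A\<close>.\<close>

lemma fresnel_gaussian_diff_le: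
  assumes "A > 0"
  shows "norm (integral {0..A} (\<lambda>u. exp (- (complex_of_real u)\<^sup>2)) -
           csqrt (- \<i>) * integral {0..A} (\<lambda>u. exp (\<i> * (of_real u)\<^sup>2))) \<le> 2 / A"
proof -
  \<comment> \<open>The segment runs from -\<i> at \<tau> = 0 to 1 at \<tau> = 1. It avoids the
    branch cut of \<open>csqrt\<close>, and its distance from 0 is at least 1/2.\<close>
  define w where "w \<tau> = Complex \<tau> (\<tau> - 1)" for \<tau> :: real
  define E where "E \<tau> = integral {0..A} (\<lambda>u. exp (- w \<tau> * (of_real u)\<^sup>2))" for \<tau>
  define E' where "E' \<tau> = integral {0..A} (\<lambda>u. - (1 + \<i>) * (of_real u)\<^sup>2 * exp (- w \<tau> * (of_real u)\<^sup>2))" for \<tau>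
  have wexp: "w \<tau> = - \<i> + (1 + \<i>) * of_real \<tau>" for \<tau>
    by (auto simp: w_def complex_eq_iff)
  have w_nonpos: "w \<tau> \<notin> \<real>\<^sub>\<le>\<^sub>0" if "\<tau> \<ge> 0" for \<tau>
    using that by (auto simp: w_def complex_nonpos_Reals_iff)
  have w0: "w \<tau> \<noteq> 0" for \<tau>
    by (auto simp: w_def complex_eq_iff)
  have nw: "norm (w \<tau>) \<ge> 1 / 2" for \<tau>
  proof -
    have "\<bar>\<tau>\<bar> + \<bar>\<tau> - 1\<bar> \<ge> 1" by simp
    then show ?thesis
      using abs_Re_le_cmod[of "w \<tau>"] abs_Im_le_cmod[of "w \<tau>"] by (simp add: w_def)
  qed
  have dE: "(E has_vector_derivative E' \<tau>) (at \<tau>)" for \<tau>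
    unfolding E_def E'_def interval_cbox
  proof (rule leibniz_rule_vector_derivative[where U = UNIV, simplified])
    fix \<tau> u :: real
    show "((\<lambda>\<tau>. exp (- w \<tau> * (of_real u)\<^sup>2)) has_vector_derivative
        - (1 + \<i>) * (of_real u)\<^sup>2 * exp (- w \<tau> * (of_real u)\<^sup>2)) (at \<tau>)"
      unfolding wexp
      by (rule has_vector_derivative_real_field) (auto intro!: derivative_eq_intros)
  next
    show "(\<lambda>u. exp (- w \<tau> * (of_real u)\<^sup>2)) integrable_on cbox 0 A" for \<tau>
      by (intro integrable_continuous continuous_intros)
    show "continuous_on (UNIV \<times> cbox 0 A)
        (\<lambda>(\<tau>, u). - (1 + \<i>) * (of_real u)\<^sup>2 * exp (- w \<tau> * (of_real u)\<^sup>2))"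
      unfolding wexp split_beta by (intro continuous_intros)
  qed
  \<comment> \<open>The derivative of u exp(-w u^2) expresses the second moment in \<open>E'\<close>
    through \<open>E\<close> itself and a boundary value at \<open>A\<close>.\<close>
  have E'_eq: "E' \<tau> = (1 + \<i>) / (2 * w \<tau>) * (of_real A * exp (- w \<tau> * (of_real A)\<^sup>2) - E \<tau>)" for \<tau>
  proof -
    have "((\<lambda>u. exp (- w \<tau> * (of_real u)\<^sup>2) - 2 * w \<tau> * (of_real u)\<^sup>2 * exp (- w \<tau> * (of_real u)\<^sup>2))
        has_integral of_real A * exp (- w \<tau> * (of_real A)\<^sup>2) - of_real 0 * exp (- w \<tau> * (of_real 0)\<^sup>2)) {0..A}"
    proof (rule fundamental_theorem_of_calculus)
      fix u :: real
      have "((\<lambda>u. u * exp (- w \<tau> * u\<^sup>2)) has_field_derivative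
          exp (- w \<tau> * v\<^sup>2) - 2 * w \<tau> * v\<^sup>2 * exp (- w \<tau> * v\<^sup>2)) (at v)" for v
        by (auto intro!: derivative_eq_intros simp: power2_eq_square algebra_simps)
      from has_vector_derivative_real_field[OF this]
      show "((\<lambda>u. of_real u * exp (- w \<tau> * (of_real u)\<^sup>2)) has_vector_derivative
          exp (- w \<tau> * (of_real u)\<^sup>2) - 2 * w \<tau> * (of_real u)\<^sup>2 * exp (- w \<tau> * (of_real u)\<^sup>2))
          (at u within {0..A})" .
    qed (use \<open>A > 0\<close> in simp)
    moreover have "((\<lambda>u. exp (- w \<tau> * (of_real u)\<^sup>2)) has_integral E \<tau>) {0..A}"
      unfolding E_def by (intro integrable_integral integrable_continuous_interval continuous_intros)
    ultimately have "((\<lambda>u. (1 + \<i>) / (2 * w \<tau>) * ((exp (- w \<tau> * (of_real u)\<^sup>2) - 2 * w \<tau> * (of_real u)\<^sup>2 * exp (- w \<tau> * (of_real u)\<^sup>2))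
        - exp (- w \<tau> * (of_real u)\<^sup>2))) has_integral
        (1 + \<i>) / (2 * w \<tau>) * (of_real A * exp (- w \<tau> * (of_real A)\<^sup>2) - E \<tau>)) {0..A}"
      by (intro has_integral_mult_right has_integral_diff) auto
    moreover have "(1 + \<i>) / (2 * w \<tau>) * ((e - 2 * w \<tau> * v * e) - e) = - (1 + \<i>) * v * e" for e v
      using w0[of \<tau>] by (simp add: field_simps)
    ultimately show ?thesis
      unfolding E'_def by (intro integral_unique) (simp only:)
  qed
  have nsq: "norm (csqrt (w \<tau>)) \<ge> 1 / 2" for \<tau>
  proof -
    have "norm (csqrt (w \<tau>)) ^ 2 = norm (w \<tau>)" by (simp flip: norm_power)
    then have "(1/2)\<^sup>2 \<le> norm (csqrt (w \<tau>)) ^ 2" using nw[of \<tau>] by (simp add: power2_eq_square)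
    then show ?thesis by (rule power2_le_imp_le) simp
  qed
  \<comment> \<open>The equation for \<open>E'\<close> is linear in \<open>E\<close>, and
    \<open>csqrt (w \<tau>)\<close> is its integrating factor: the derivative of the product keeps
    only the boundary term. As 1 + \<i> has norm at most 2 and the root has norm at least 1/2, that
    term is at most \<open>2 * A * exp (- \<tau> * A\<^sup>2)\<close>, whose integral over [0, 1] is
    below 2/A.\<close>
  have "norm (csqrt (w 1) * E 1 - csqrt (w 0) * E 0) \<le> - 2 / A * exp (- 1 * A\<^sup>2) - (- 2 / A * exp (- 0 * A\<^sup>2))"
  proof (rule differentiable_bound_general[where a = 0 and b = 1
        and f' = "\<lambda>\<tau>. (1 + \<i>) / (2 * csqrt (w \<tau>)) * (of_real A * exp (- w \<tau> * (of_real A)\<^sup>2))"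
        and \<phi>' = "\<lambda>\<tau>. 2 * A * exp (- \<tau> * A\<^sup>2)"])
    have der: "((\<lambda>\<tau>. csqrt (w \<tau>) * E \<tau>) has_vector_derivative
        (1 + \<i>) / (2 * csqrt (w \<tau>)) * (of_real A * exp (- w \<tau> * (of_real A)\<^sup>2))) (at \<tau>)"
      if "\<tau> \<ge> 0" for \<tau>
    proof -
      have "((\<lambda>\<tau>. csqrt (w \<tau>)) has_vector_derivative (1 + \<i>) / (2 * csqrt (w \<tau>))) (at \<tau>)"
        using w_nonpos[OF that] unfolding wexp
        by (intro has_vector_derivative_real_field) (auto intro!: derivative_eq_intros)
      from has_vector_derivative_mult[OF this dE[of \<tau>]] show ?thesis
      proof (rule has_vector_derivative_eq_rhs)
        have sq: "w \<tau> = csqrt (w \<tau>) * csqrt (w \<tau>)"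
          by (metis power2_csqrt power2_eq_square)
        have "csqrt (w \<tau>) * E' \<tau> = (1 + \<i>) / (2 * csqrt (w \<tau>)) * (of_real A * exp (- w \<tau> * (of_real A)\<^sup>2) - E \<tau>)"
          unfolding E'_eq by (subst (2) sq) (use w0[of \<tau>] in \<open>simp add: field_simps\<close>)
        then show "csqrt (w \<tau>) * E' \<tau> + (1 + \<i>) / (2 * csqrt (w \<tau>)) * E \<tau> =
            (1 + \<i>) / (2 * csqrt (w \<tau>)) * (of_real A * exp (- w \<tau> * (of_real A)\<^sup>2))"
          by (simp add: algebra_simps)
      qed
    qed
    then show "\<And>\<tau>. 0 < \<tau> \<Longrightarrow> \<tau> < 1 \<Longrightarrow> ((\<lambda>\<tau>. csqrt (w \<tau>) * E \<tau>) has_vector_derivative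
        (1 + \<i>) / (2 * csqrt (w \<tau>)) * (of_real A * exp (- w \<tau> * (of_real A)\<^sup>2))) (at \<tau>)"
      by simp
    show "continuous_on {0..1} (\<lambda>\<tau>. csqrt (w \<tau>) * E \<tau>)"
      by (intro continuous_at_imp_continuous_on ballI has_vector_derivative_continuous[OF der]) simp
    show "continuous_on {0..1} (\<lambda>\<tau>. - 2 / A * exp (- \<tau> * A\<^sup>2))"
      by (intro continuous_intros) (use \<open>A > 0\<close> in auto)
    show "((\<lambda>\<tau>. - 2 / A * exp (- \<tau> * A\<^sup>2)) has_vector_derivative 2 * A * exp (- \<tau> * A\<^sup>2)) (at \<tau>)" for \<tau>
      unfolding has_real_derivative_iff_has_vector_derivative[symmetric] using \<open>A > 0\<close>
      by (auto intro!: derivative_eq_intros simp: power2_eq_square)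
    fix \<tau> :: real assume "0 < \<tau>" "\<tau> < 1"
    have "norm (1 + \<i>) \<le> 2"
      using norm_triangle_ineq[of 1 \<i>] by simp
    then have "norm ((1 + \<i>) / (2 * csqrt (w \<tau>))) \<le> 2 / (2 * (1 / 2))"
      using nsq[of \<tau>] unfolding norm_divide norm_mult norm_numeral by (intro frac_le) auto
    moreover have "norm (of_real A * exp (- w \<tau> * (of_real A)\<^sup>2)) = A * exp (- \<tau> * A\<^sup>2)"
      using \<open>A > 0\<close> by (simp add: norm_mult w_def flip: of_real_power)
    ultimately show "norm ((1 + \<i>) / (2 * csqrt (w \<tau>)) * (of_real A * exp (- w \<tau> * (of_real A)\<^sup>2))) \<le> 2 * A * exp (- \<tau> * A\<^sup>2)"
      using \<open>A > 0\<close> unfolding norm_mult[of "_ / _"] by (simp add: mult_right_mono)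
  qed auto
  also have "\<dots> \<le> 2 / A"
    using \<open>A > 0\<close> by simp
  finally show ?thesis
    by (simp add: E_def wexp)
qed

text \<open>The origin of the phase shift pi/4: the factor between the Gaussian and the Fresnel
  integral is \<open>csqrt (- \<i>)\<close>, the root with positive real part, which is cis
  (-pi/4).\<close>

lemma fresnel_tendsto:
  "((\<lambda>A. integral {0..A} (\<lambda>u. exp (\<i> * (of_real u)\<^sup>2))) \<longlongrightarrow> of_real (sqrt pi / 2) * cis (pi / 4)) at_top"
proof -
  have c: "csqrt (- \<i>) * cis (pi / 4) = 1"
  proof -
    have "csqrt (- \<i>) = cis (- pi / 4)"
      by (rule csqrt_unique) (auto simp: cis_mult power2_eq_square complex_eq_iff cos_45 sin_45)
    then show ?thesis by (simp add: cis_mult)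
  qed
  have gauss: "((\<lambda>A. integral {0..A} (\<lambda>u. exp (- (complex_of_real u)\<^sup>2))) \<longlongrightarrow> of_real (sqrt pi / 2)) at_top"
  proof -
    have "integral {0..A} (\<lambda>u. exp (- (complex_of_real u)\<^sup>2)) = of_real (integral {0..A} (\<lambda>u. exp (- u\<^sup>2)))" for A
    proof (rule integral_unique)
      have "((\<lambda>u. exp (- u\<^sup>2)) has_integral integral {0..A} (\<lambda>u. exp (- u\<^sup>2) :: real)) {0..A}"
        by (intro integrable_integral integrable_continuous_interval continuous_intros)
      then show "((\<lambda>u. exp (- (complex_of_real u)\<^sup>2)) has_integral of_real (integral {0..A} (\<lambda>u. exp (- u\<^sup>2)))) {0..A}"
        using has_integral_of_real[of "\<lambda>u. exp (- u\<^sup>2)"] by (simp add: exp_of_real flip: of_real_minus of_real_power)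
    qed
    then show ?thesis
      unfolding fun_eq_iff by (simp only: tendsto_of_real[OF tendsto_integral_gaussian])
  qed
  have eq: "(g - (g - csqrt (- \<i>) * j)) * cis (pi / 4) = j" for g j
    using c by (simp add: mult.assoc mult.left_commute[of _ j])
  have "((\<lambda>A. integral {0..A} (\<lambda>u. exp (- (complex_of_real u)\<^sup>2)) -
           csqrt (- \<i>) * integral {0..A} (\<lambda>u. exp (\<i> * (of_real u)\<^sup>2))) \<longlongrightarrow> 0) at_top"
  proof (rule Lim_null_comparison)
    show "((\<lambda>A::real. 2 / A) \<longlongrightarrow> 0) at_top" by real_asymp
    show "\<forall>\<^sub>F A in at_top. norm (integral {0..A} (\<lambda>u. exp (- (complex_of_real u)\<^sup>2)) -
           csqrt (- \<i>) * integral {0..A} (\<lambda>u. exp (\<i> * (of_real u)\<^sup>2))) \<le> 2 / A"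
      using eventually_gt_at_top[of 0] by eventually_elim (rule fresnel_gaussian_diff_le)
  qed
  from tendsto_mult[OF tendsto_diff[OF gauss this] tendsto_const[of "cis (pi / 4)"]]
  show ?thesis
    unfolding eq diff_zero .
qed

text \<open>The cosine is the real part of cis b times the Fresnel integrand in the variable a (s -
  1). That integrand is even, so the symmetric range folds onto \<open>{0..a * \<delta>}\<close> and
  produces the 2.\<close>

lemma integral_cos_quadratic:
  fixes a b \<delta> :: real
  assumes "a > 0" "\<delta> \<ge> 0"
  shows "integral {1 - \<delta>..1 + \<delta>} (\<lambda>s. cos (b + (a * (s - 1))\<^sup>2)) =
    2 / a * Re (cis b * integral {0..a * \<delta>} (\<lambda>u. exp (\<i> * (of_real u)\<^sup>2)))"
proof -
  define f :: "real \<Rightarrow> complex" where "f u = exp (\<i> * (of_real u)\<^sup>2)" for u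
  have "isCont f u" for u
    unfolding f_def[abs_def] by (intro continuous_intros)
  then obtain P where P: "\<And>u. (P has_vector_derivative f u) (at u)"
    using einterval_antiderivative[of "-\<infinity>" "\<infinity>" f] by auto
  \<comment> \<open>\<open>P x + P (- x)\<close> has derivative 0, so the mean value inequality with
    a constant majorant shows that it keeps its value at 0.\<close>
  have odd: "P x - P (- x) = 2 * (P x - P 0)" for x
  proof -
    have "norm ((P x + P (- x)) - (P 0 + P (- 0))) \<le> \<bar>0 - 0\<bar>"
    proof (rule norm_diff_le_abs_diff[where I = UNIV and f = "\<lambda>x. P x + P (- x)"
          and f' = "\<lambda>_. 0" and \<Phi> = "\<lambda>_. 0" and \<Phi>' = "\<lambda>_. 0"])
      fix u :: real
      have "((\<lambda>x. P (- x)) has_vector_derivative (- 1) *\<^sub>R f (- u)) (at u)"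
        using vector_diff_chain_at[of uminus "-1" u P "f (- u)"] P[of "- u"]
        by (simp add: o_def has_vector_derivative_minus has_vector_derivative_id)
      from has_vector_derivative_add[OF P[of u] this]
      show "((\<lambda>x. P x + P (- x)) has_vector_derivative 0) (at u)"
        by (simp add: f_def)
    qed auto
    then show ?thesis by (simp add: algebra_simps)
  qed
  have J: "integral {0..a * \<delta>} f = P (a * \<delta>) - P 0"
    using assms P
    by (intro integral_unique fundamental_theorem_of_calculus) (auto intro: has_vector_derivative_at_within)
  have "((\<lambda>s. cos (b + (a * (s - 1))\<^sup>2)) has_integral
      Re (cis b * P (a * (1 + \<delta> - 1))) / a - Re (cis b * P (a * (1 - \<delta> - 1))) / a) {1 - \<delta>..1 + \<delta>}"
  proof (rule fundamental_theorem_of_calculus)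
    fix s :: real
    have "((\<lambda>s. P (a * (s - 1))) has_vector_derivative a *\<^sub>R f (a * (s - 1))) (at s)"
    proof -
      have "((\<lambda>s. a * (s - 1)) has_vector_derivative a) (at s)"
        unfolding has_real_derivative_iff_has_vector_derivative[symmetric]
        by (auto intro!: derivative_eq_intros)
      from vector_diff_chain_at[OF this P] show ?thesis by (simp add: o_def)
    qed
    then have "((\<lambda>s. cis b * P (a * (s - 1))) has_vector_derivative cis b * (a *\<^sub>R f (a * (s - 1)))) (at s)"
      by (rule has_vector_derivative_mult_right)
    then have "((\<lambda>s. Re (cis b * P (a * (s - 1)))) has_vector_derivative Re (cis b * (a *\<^sub>R f (a * (s - 1))))) (at s)"
      by (rule bounded_linear.has_vector_derivative[OF bounded_linear_Re])
    then have "((\<lambda>s. Re (cis b * P (a * (s - 1))) / a) has_real_derivative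
        Re (cis b * (a *\<^sub>R f (a * (s - 1)))) / a) (at s)"
      unfolding has_real_derivative_iff_has_vector_derivative[symmetric] by (rule DERIV_cdivide)
    moreover have "Re (cis b * (a *\<^sub>R f (a * (s - 1)))) / a = cos (b + (a * (s - 1))\<^sup>2)"
    proof -
      have "f (a * (s - 1)) = cis ((a * (s - 1))\<^sup>2)"
        by (simp add: f_def cis_conv_exp)
      then show ?thesis
        using assms by (simp add: cos_add field_simps)
    qed
    ultimately show "((\<lambda>s. Re (cis b * P (a * (s - 1))) / a) has_vector_derivative cos (b + (a * (s - 1))\<^sup>2))
        (at s within {1 - \<delta>..1 + \<delta>})"
      by (simp add: has_real_derivative_iff_has_vector_derivative has_vector_derivative_at_within)
  qed (use assms in auto)
  then have "integral {1 - \<delta>..1 + \<delta>} (\<lambda>s. cos (b + (a * (s - 1))\<^sup>2)) =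
      Re (cis b * P (a * \<delta>)) / a - Re (cis b * P (- (a * \<delta>))) / a"
    by (simp add: integral_unique)
  also have "\<dots> = Re (cis b * (P (a * \<delta>) - P (- (a * \<delta>)))) / a"
    by (simp only: right_diff_distrib minus_complex.simps diff_divide_distrib)
  also have "\<dots> = 2 / a * Re (cis b * integral {0..a * \<delta>} f)"
  proof -
    have "Re (w * (2 * v)) = 2 * Re (w * v)" for w v
      by (simp add: algebra_simps)
    then show ?thesis unfolding odd J by (simp only: times_divide_eq_left)
  qed
  finally show ?thesis by (simp add: f_def[abs_def])
qed

text \<open>After rescaling, the Fresnel integral ends at
  \<open>sqrt (\<omega> * \<kappa>) * \<delta> \<omega>\<close>, which grows like \<omega>^(1/10)
  for this \<open>\<delta>\<close>. Hence the truncation disappears in the limit, and the full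
  Fresnel integral contributes 2/sqrt \<kappa> times sqrt pi/2.\<close>

lemma fresnel_main_term:
  fixes \<kappa> c :: real
  assumes "\<kappa> > 0"
  defines "\<delta> \<equiv> \<lambda>\<omega>. \<omega> powr (- 2 / 5)"
  shows "((\<lambda>\<omega>. sqrt \<omega> * integral {1 - \<delta> \<omega>..1 + \<delta> \<omega>} (\<lambda>s. cos (\<omega> * c + \<omega> * \<kappa> * (s - 1)\<^sup>2)) -
    sqrt (pi / \<kappa>) * cos (\<omega> * c + pi / 4)) \<longlongrightarrow> 0) at_top"
proof (rule Lim_null_comparison)
  define J where "J A = integral {0..A} (\<lambda>u. exp (\<i> * (complex_of_real u)\<^sup>2))" for A
  define L where "L = of_real (sqrt pi / 2) * cis (pi / 4)"
  have lim: "filterlim (\<lambda>\<omega>. sqrt (\<omega> * \<kappa>) * \<delta> \<omega>) at_top at_top"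
    unfolding \<delta>_def using \<open>\<kappa> > 0\<close> by real_asymp
  have "((\<lambda>A. norm (J A - L)) \<longlongrightarrow> 0) at_top"
    using fresnel_tendsto unfolding J_def[abs_def, symmetric] L_def[symmetric]
    by (intro tendsto_norm_zero LIM_zero)
  from tendsto_mult[OF tendsto_const[of "2 / sqrt \<kappa>"] filterlim_compose[OF this lim]]
  show "((\<lambda>\<omega>. 2 / sqrt \<kappa> * norm (J (sqrt (\<omega> * \<kappa>) * \<delta> \<omega>) - L)) \<longlongrightarrow> 0) at_top" by simp
  show "\<forall>\<^sub>F \<omega> in at_top. norm (sqrt \<omega> * integral {1 - \<delta> \<omega>..1 + \<delta> \<omega>} (\<lambda>s. cos (\<omega> * c + \<omega> * \<kappa> * (s - 1)\<^sup>2)) -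
      sqrt (pi / \<kappa>) * cos (\<omega> * c + pi / 4)) \<le> 2 / sqrt \<kappa> * norm (J (sqrt (\<omega> * \<kappa>) * \<delta> \<omega>) - L)"
    using eventually_gt_at_top[of 0]
  proof eventually_elim
    case (elim \<omega>)
    define a where "a = sqrt (\<omega> * \<kappa>)"
    have a: "a > 0" "sqrt \<omega> / a = 1 / sqrt \<kappa>"
      using elim \<open>\<kappa> > 0\<close> by (auto simp: a_def real_sqrt_mult)
    have a2: "a\<^sup>2 = \<omega> * \<kappa>"
      using elim \<open>\<kappa> > 0\<close> by (simp add: a_def)
    have "integral {1 - \<delta> \<omega>..1 + \<delta> \<omega>} (\<lambda>s. cos (\<omega> * c + \<omega> * \<kappa> * (s - 1)\<^sup>2)) =
        2 / a * Re (cis (\<omega> * c) * J (a * \<delta> \<omega>))"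
      using integral_cos_quadratic[of a "\<delta> \<omega>" "\<omega> * c"] a a2
      by (simp add: power_mult_distrib J_def \<delta>_def)
    then have "sqrt \<omega> * integral {1 - \<delta> \<omega>..1 + \<delta> \<omega>} (\<lambda>s. cos (\<omega> * c + \<omega> * \<kappa> * (s - 1)\<^sup>2)) =
        2 * (sqrt \<omega> / a) * Re (cis (\<omega> * c) * J (a * \<delta> \<omega>))" by simp
    also have "\<dots> = 2 / sqrt \<kappa> * Re (cis (\<omega> * c) * J (a * \<delta> \<omega>))" unfolding a(2) by simp
    finally have 1: "sqrt \<omega> * integral {1 - \<delta> \<omega>..1 + \<delta> \<omega>} (\<lambda>s. cos (\<omega> * c + \<omega> * \<kappa> * (s - 1)\<^sup>2)) =
        2 / sqrt \<kappa> * Re (cis (\<omega> * c) * J (a * \<delta> \<omega>))" .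
    have "cis (\<omega> * c) * L = of_real (sqrt pi / 2) * cis (\<omega> * c + pi / 4)"
      by (simp add: L_def cis_mult mult.left_commute)
    then have "Re (cis (\<omega> * c) * L) = sqrt pi / 2 * cos (\<omega> * c + pi / 4)"
      by (simp only:) simp
    then have 2: "sqrt (pi / \<kappa>) * cos (\<omega> * c + pi / 4) = 2 / sqrt \<kappa> * Re (cis (\<omega> * c) * L)"
      by (simp add: real_sqrt_divide)
    have "norm (Re (cis (\<omega> * c) * (J (a * \<delta> \<omega>) - L))) \<le> norm (cis (\<omega> * c) * (J (a * \<delta> \<omega>) - L))"
      unfolding real_norm_def by (rule abs_Re_le_cmod)
    also have "\<dots> = norm (J (a * \<delta> \<omega>) - L)" by (simp add: norm_mult)
    finally have 3: "norm (Re (cis (\<omega> * c) * (J (a * \<delta> \<omega>) - L))) \<le> norm (J (a * \<delta> \<omega>) - L)" .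
    have 4: "2 / sqrt \<kappa> * Re (cis (\<omega> * c) * J (a * \<delta> \<omega>)) - 2 / sqrt \<kappa> * Re (cis (\<omega> * c) * L) =
        2 / sqrt \<kappa> * Re (cis (\<omega> * c) * (J (a * \<delta> \<omega>) - L))"
      by (simp only: right_diff_distrib minus_complex.simps)
    have "norm (2 / sqrt \<kappa>) = 2 / sqrt \<kappa>" using \<open>\<kappa> > 0\<close> by simp
    then show ?case
      unfolding 1 2 4 a_def[symmetric] norm_mult[of "2 / sqrt \<kappa>"]
      using mult_left_mono[OF 3, of "2 / sqrt \<kappa>"] \<open>\<kappa> > 0\<close> by (simp only:) simp
  qed
qed

lemma abs_cos_diff_le: "\<bar>cos x - cos y\<bar> \<le> \<bar>x - y\<bar>" for x y :: real
  using norm_diff_le_abs_diff[of UNIV y x cos "\<lambda>x. - sin x" "\<lambda>x. x" "\<lambda>_. 1"]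
  by (auto intro!: derivative_eq_intros simp: has_real_derivative_iff_has_vector_derivative[symmetric])

section \<open>The scaled integral\<close>

lemma powr_Suc_complex: "s > 0 \<Longrightarrow> complex_of_real s powr (w + 1) = of_real s powr w * of_real s"
  by (simp add: powr_add)

lemma has_vector_derivative_of_real_powr:
  assumes "s > 0"
  shows "((\<lambda>s. complex_of_real s powr w) has_vector_derivative w * of_real s powr (w - 1)) (at s)"
  by (rule has_vector_derivative_real_field) (use assms in \<open>auto intro!: has_field_derivative_powr\<close>)

lemma norm_of_real_powr: "s > 0 \<Longrightarrow> norm (complex_of_real s powr w) = s powr Re w"
  by (simp add: norm_powr_real_powr)

lemma powr_at_right_0: "a > 0 \<Longrightarrow> ((\<lambda>s::real. s powr a) \<longlongrightarrow> 0) (at_right 0)"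
proof -
  assume "a > 0"
  have "eventually (\<lambda>s::real. 0 \<le> s) (at_right 0)"
    using eventually_at_right_less[of "0::real"] by (rule eventually_mono) simp
  then have "((\<lambda>s. s powr a) \<longlongrightarrow> 0 powr a) (at_right 0)"
    using \<open>a > 0\<close> by (intro tendsto_powr' tendsto_ident_at tendsto_const) auto
  then show ?thesis by simp
qed

lemma powr_at_top_neg: "a < 0 \<Longrightarrow> ((\<lambda>s::real. s powr a) \<longlongrightarrow> 0) at_top"
  by (rule tendsto_neg_powr[OF _ filterlim_ident])

lemma at_right_prod_at_top_neq_bot: "at_right (0::real) \<times>\<^sub>F (at_top :: real filter) \<noteq> bot"
  by (simp add: prod_filter_eq_bot)

lemma integral_scale_real:
  fixes f :: "real \<Rightarrow> 'a::euclidean_space"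
  assumes "m > 0" "f integrable_on {a..b}"
  shows "integral {a..b} f = m *\<^sub>R integral {a / m..b / m} (\<lambda>s. f (m * s))"
proof -
  have "(f has_integral integral {a..b} f) (cbox a b)"
    using assms(2) by (simp add: integrable_integral)
  from has_integral_affinity[OF this, of m 0] assms(1)
  have "((\<lambda>s. f (m * s)) has_integral (1 / m) *\<^sub>R integral {a..b} f) ((\<lambda>x. x / m) ` {a..b})"
    by (simp add: divide_inverse mult.commute)
  also have "(\<lambda>x. x / m) ` {a..b} = {a / m..b / m}"
    using assms(1) by (simp add: image_divide_atLeastAtMost)
  finally have "integral {a / m..b / m} (\<lambda>s. f (m * s)) = (1 / m) *\<^sub>R integral {a..b} f"
    by (rule integral_unique)
  then show ?thesis using assms(1) by simp
qed

lemma exp_of_real_mult_ln: "x > 0 \<Longrightarrow> complex_of_real x powr w = exp (w * of_real (ln x))"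
  by (simp add: powr_def Ln_of_real)

locale scaled_integrand =
  fixes k :: nat and z :: complex
  assumes k: "k \<ge> 1" and z: "-1 < Re z" "Re z < real k"
begin

text \<open>Only \<^term>\<open>e = 1\<close>, with a stationary point at \<^term>\<open>1\<close>, and \<^term>\<open>e = - 1\<close>, with none, are
  needed.\<close>

definition phase :: "real \<Rightarrow> real \<Rightarrow> real" where
  "phase e s = real k * s + e / s ^ k"

definition phase' :: "real \<Rightarrow> real \<Rightarrow> real" where
  "phase' e s = real k * (s ^ (k + 1) - e) / s ^ (k + 1)"

text \<open>The quotient of \<^term>\<open>of_real s powr (z - of_nat k)\<close> by \<open>phase' e s\<close>, with the powers of
  \<^term>\<open>s\<close> collected so that the decay at both ends is visible.\<close>

definition weight :: "real \<Rightarrow> real \<Rightarrow> complex" where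
  "weight e s = of_real s powr (z + 1) * of_real (1 / (real k * (s ^ (k + 1) - e)))"

definition weight' :: "real \<Rightarrow> real \<Rightarrow> complex" where
  "weight' e s = of_real s powr z *
     ((z + 1) * of_real (s ^ (k + 1) - e) - of_real ((real k + 1) * s ^ (k + 1))) *
     of_real (1 / (real k * (s ^ (k + 1) - e)\<^sup>2))"

definition wconst :: real where
  "wconst = (norm (z + 1) + real k + 1) / real k"

lemma wconst_pos: "wconst > 0"
  using k unfolding wconst_def by (intro divide_pos_pos add_nonneg_pos) auto

section \<open>Derivative, size and decay of the weight\<close>

lemma has_real_derivative_phase:
  assumes "s > 0"
  shows "(phase e has_real_derivative phase' e s) (at s)"
proof -
  obtain m where m: "k = Suc m" using k by (cases k) auto
  have "((\<lambda>s. s ^ k) has_real_derivative real k * s ^ m) (at s)"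
    using DERIV_pow[of k s] by (simp add: m)
  then have "((\<lambda>s. real k * s + e / s ^ k) has_real_derivative
      real k * 1 + (0 * s ^ k - e * (real k * s ^ m)) / (s ^ k * s ^ k)) (at s)"
    using assms by (intro DERIV_add DERIV_cmult DERIV_ident DERIV_divide DERIV_const) auto
  then show ?thesis
    unfolding phase_def[abs_def] phase'_def
    by (rule DERIV_cong) (use assms in \<open>simp add: m field_simps\<close>)
qed

lemma has_vector_derivative_weight:
  assumes "s > 0" "s ^ (k + 1) \<noteq> e"
  shows "(weight e has_vector_derivative weight' e s) (at s)"
proof -
  define d where "d = s ^ (k + 1) - e"
  have d: "d \<noteq> 0" "real k \<noteq> 0" using assms k by (auto simp: d_def)
  obtain m where m: "k = Suc m" using k by (cases k) auto
  have "((\<lambda>s. 1 / (real k * (s ^ (k + 1) - e))) has_real_derivative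
      - ((real k + 1) * s ^ k) / (real k * d\<^sup>2)) (at s)"
    using d unfolding d_def
    by (auto intro!: derivative_eq_intros simp: power2_eq_square divide_simps) (simp add: m algebra_simps)
  then have "((\<lambda>s. complex_of_real (1 / (real k * (s ^ (k + 1) - e)))) has_vector_derivative
      of_real (- ((real k + 1) * s ^ k) / (real k * d\<^sup>2))) (at s)"
    by (intro has_vector_derivative_of_real) (simp add: has_real_derivative_iff_has_vector_derivative)
  from has_vector_derivative_mult[OF has_vector_derivative_of_real_powr[OF assms(1)] this]
  show ?thesis
    unfolding weight_def[abs_def]
  proof (rule has_vector_derivative_eq_rhs)
    have "of_real s powr (z + 1) * of_real (- ((real k + 1) * s ^ k) / (real k * d\<^sup>2)) +
        (z + 1) * of_real s powr (z + 1 - 1) * of_real (1 / (real k * d)) =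
        of_real s powr z * ((z + 1) * of_real d - of_real ((real k + 1) * s ^ (k + 1))) *
          complex_of_real (1 / (real k * d\<^sup>2))"
      using d unfolding powr_Suc_complex[OF assms(1)] by (simp add: field_simps power2_eq_square)
    then show "of_real s powr (z + 1) * of_real (- ((real k + 1) * s ^ k) / (real k * d\<^sup>2)) +
        (z + 1) * of_real s powr (z + 1 - 1) * of_real (1 / (real k * (s ^ (k + 1) - e))) = weight' e s"
      unfolding weight'_def d_def .
  qed
qed

text \<open>Brings the integrand into the form weight times phase derivative that
  \<open>oscillatory_tail\<close> expects.\<close>

lemma weight_mult_phase':
  assumes "s > 0" "s ^ (k + 1) \<noteq> e"
  shows "weight e s * of_real (phase' e s) = of_real s powr (z - of_nat k)"
proof -
  have "complex_of_real s powr (z + 1) = of_real s powr (z - of_nat k) * of_real s powr (of_nat (k + 1))"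
    using assms by (simp flip: powr_add)
  also have "of_real s powr (of_nat (k + 1)) = complex_of_real s ^ (k + 1)"
    using assms by (subst powr_nat') auto
  finally have "complex_of_real s powr (z + 1) = of_real s powr (z - of_nat k) * of_real (s ^ (k + 1))"
    by simp
  moreover have "s ^ (k + 1) * (1 / (real k * (s ^ (k + 1) - e)) * phase' e s) = 1"
    using assms k by (simp add: phase'_def)
  ultimately show ?thesis
    unfolding weight_def by (simp only: mult.assoc of_real_mult[symmetric] of_real_1 mult_1_right)
qed

text \<open>Both terms of the numerator are estimated crudely by multiples of
  \<open>s ^ (k + 1) + 1\<close>. The denominator is kept exact: for \<open>e = 1\<close> its double
  zero at 1 decides how the tail bounds depend on \<delta>.\<close>

lemma norm_weight'_le:
  assumes "s > 0" "\<bar>e\<bar> = 1"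
  shows "norm (weight' e s) \<le> wconst * (s powr Re z * (s ^ (k + 1) + 1) / (s ^ (k + 1) - e)\<^sup>2)"
proof -
  have "norm ((z + 1) * of_real (s ^ (k + 1) - e) - of_real ((real k + 1) * s ^ (k + 1)))
      \<le> norm (z + 1) * \<bar>s ^ (k + 1) - e\<bar> + (real k + 1) * s ^ (k + 1)"
    using assms by (intro order_trans[OF norm_triangle_ineq4]) (simp only: norm_mult norm_of_real, simp)
  also have "\<dots> \<le> norm (z + 1) * (s ^ (k + 1) + 1) + (real k + 1) * (s ^ (k + 1) + 1)"
  proof (intro add_mono mult_left_mono)
    have "s ^ (k + 1) > 0" using assms by simp
    then show "\<bar>s ^ (k + 1) - e\<bar> \<le> s ^ (k + 1) + 1" using assms(2) by linarith
  qed auto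
  finally have n: "norm ((z + 1) * of_real (s ^ (k + 1) - e) - of_real ((real k + 1) * s ^ (k + 1)))
      \<le> (norm (z + 1) + real k + 1) * (s ^ (k + 1) + 1)" (is "?n \<le> ?b")
    by (simp add: algebra_simps)
  have "norm (weight' e s) = s powr Re z * ?n * (1 / (real k * (s ^ (k + 1) - e)\<^sup>2))"
    unfolding weight'_def norm_mult norm_of_real norm_of_real_powr[OF assms(1)]
    by (simp add: abs_mult)
  also have "\<dots> \<le> s powr Re z * ?b * (1 / (real k * (s ^ (k + 1) - e)\<^sup>2))"
    using n by (intro mult_right_mono mult_left_mono) auto
  also have "\<dots> = wconst * (s powr Re z * (s ^ (k + 1) + 1) / (s ^ (k + 1) - e)\<^sup>2)"
    by (simp add: wconst_def)
  finally show ?thesis .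
qed

text \<open>Here the lower bound on \<open>Re z\<close> enters: \<open>Re z + 1\<close> is positive,
  and the other factor has a finite limit because \<open>e\<close> is nonzero.\<close>

lemma weight_tendsto_0_at_right:
  assumes "\<bar>e\<bar> = 1"
  shows "(weight e \<longlongrightarrow> 0) (at_right 0)"
proof -
  have 1: "((\<lambda>s. s powr (Re z + 1)) \<longlongrightarrow> 0) (at_right 0)"
    by (rule powr_at_right_0) (use z in simp)
  have 2: "((\<lambda>s. \<bar>1 / (real k * (s ^ (k + 1) - e))\<bar>) \<longlongrightarrow> \<bar>1 / (real k * (0 ^ (k + 1) - e))\<bar>) (at_right 0)"
    using assms k by (intro tendsto_intros) auto
  have "((\<lambda>s. norm (weight e s)) \<longlongrightarrow> 0) (at_right 0)"
  proof (rule Lim_transform_eventually)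
    show "((\<lambda>s. s powr (Re z + 1) * \<bar>1 / (real k * (s ^ (k + 1) - e))\<bar>) \<longlongrightarrow> 0) (at_right 0)"
      using tendsto_mult[OF 1 2] by simp
    show "\<forall>\<^sub>F s in at_right 0. s powr (Re z + 1) * \<bar>1 / (real k * (s ^ (k + 1) - e))\<bar> = norm (weight e s)"
      using eventually_at_right_less[of "0::real"]
      by eventually_elim (simp only: weight_def norm_mult norm_of_real norm_of_real_powr, simp)
  qed
  then show ?thesis by (rule tendsto_norm_zero_cancel)
qed

text \<open>Here the upper bound on \<open>Re z\<close> enters. From 2 on,
  \<open>s ^ (k + 1)\<close> is at least 2, so subtracting \<open>e\<close> costs at most half of it
  and the weight is at most a multiple of \<open>s powr (Re z - real k)\<close>.\<close>

lemma weight_tendsto_0_at_top: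
  assumes "\<bar>e\<bar> = 1"
  shows "(weight e \<longlongrightarrow> 0) at_top"
proof (rule Lim_null_comparison)
  show "((\<lambda>s. 2 * s powr (Re z - real k)) \<longlongrightarrow> 0) at_top"
    using tendsto_mult[OF tendsto_const tendsto_neg_powr[OF _ filterlim_ident], of "Re z - real k" 2] z by simp
  show "\<forall>\<^sub>F s in at_top. norm (weight e s) \<le> 2 * s powr (Re z - real k)"
    using eventually_ge_at_top[of 2]
  proof eventually_elim
    case (elim s)
    define p where "p = s ^ (k + 1)"
    have "p \<ge> s ^ 1" unfolding p_def using elim by (intro power_increasing) auto
    then have p: "p \<ge> 2" using elim by simp
    then have "\<bar>p - e\<bar> \<ge> p / 2" using assms by arith
    moreover have "real k \<ge> 1" using k by simp
    ultimately have "real k * \<bar>p - e\<bar> \<ge> 1 * (p / 2)"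
      using p by (intro mult_mono) auto
    then have "1 / (real k * \<bar>p - e\<bar>) \<le> 1 / (p / 2)"
      using p by (intro frac_le) auto
    then have "s powr (Re z + 1) * (1 / (real k * \<bar>p - e\<bar>)) \<le> s powr (Re z + 1) * (1 / (p / 2))"
      by (intro mult_left_mono) auto
    also have "\<dots> = 2 * s powr (Re z + 1 - real (k + 1))"
      unfolding p_def using elim by (subst powr_diff) (simp add: powr_realpow del: of_nat_Suc of_nat_add)
    finally have "s powr (Re z + 1) * (1 / (real k * \<bar>p - e\<bar>)) \<le> 2 * s powr (Re z - real k)"
      by simp
    moreover have "norm (weight e s) = s powr (Re z + 1) * (1 / (real k * \<bar>p - e\<bar>))"
      using elim unfolding weight_def norm_mult norm_of_real p_def
      by (subst norm_of_real_powr) (auto simp: abs_mult)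
    ultimately show ?case by simp
  qed
qed

section \<open>Limits of antiderivatives at 0 and at infinity\<close>

text \<open>Fixed only up to a constant, which cancels since only differences are used. The ends 0
  and infinity are reached through limits of \<open>Q\<close>, so a tail is the difference of a
  limit and a value.\<close>

definition primitive :: "real \<Rightarrow> real \<Rightarrow> (real \<Rightarrow> complex) \<Rightarrow> bool" where
  "primitive e \<omega> Q \<longleftrightarrow> (\<forall>s>0. (Q has_vector_derivative
     of_real s powr (z - of_nat k) * of_real (cos (\<omega> * phase e s))) (at s))"

text \<open>\<open>I\<close> has to avoid the zeros of \<open>phase' e\<close>, where the weight is
  singular. The choice left to each application is a majorant of \<open>weight'\<close> with a known
  antiderivative.\<close>

lemma primitive_tail:
  assumes "primitive e \<omega> Q" "\<omega> > 0"
    and net: "net \<noteq> bot" "eventually (\<lambda>x. x \<in> I) net"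
    and I: "convex I" "c \<in> I" "I \<subseteq> {0<..}" "\<And>s. s \<in> I \<Longrightarrow> s ^ (k + 1) \<noteq> e"
    and \<Phi>: "\<And>s. s \<in> I \<Longrightarrow> (\<Phi> has_real_derivative \<Phi>' s) (at s)"
    and bd: "\<And>s. s \<in> I \<Longrightarrow> norm (weight' e s) \<le> \<Phi>' s"
    and lim: "(weight e \<longlongrightarrow> 0) net" "(\<Phi> \<longlongrightarrow> L) net"
  shows "\<exists>T. (Q \<longlongrightarrow> T) net \<and> norm (T - Q c) \<le> 2 * \<bar>L - \<Phi> c\<bar> / \<omega>"
proof -
  have "(Q has_vector_derivative weight e s * of_real (phase' e s) * of_real (cos (\<omega> * phase e s))) (at s)"
    if "s \<in> I" for s
    using assms(1) I that unfolding primitive_def by (subst weight_mult_phase') auto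
  moreover have "(phase e has_real_derivative phase' e s) (at s)" if "s \<in> I" for s
    using I that by (intro has_real_derivative_phase) auto
  moreover have "(weight e has_vector_derivative weight' e s) (at s)" if "s \<in> I" for s
    using I that by (intro has_vector_derivative_weight) auto
  ultimately show ?thesis
    using oscillatory_tail[OF net I(1,2) \<open>\<omega> > 0\<close> _ _ \<Phi> bd _ lim, where \<psi> = "phase e" and \<psi>' = "phase' e" and Q = Q]
    by blast
qed

text \<open>For \<open>e = - 1\<close> the denominator never vanishes, so both ends are compared
  with the value at 1 and no \<delta> enters. Of the two majorants, \<open>s powr Re z\<close> is
  integrable at 0 and \<open>s powr (Re z - real k - 1)\<close> at infinity.\<close>

lemma nonstationary:
  obtains K where "\<And>\<omega> Q. \<omega> > 0 \<Longrightarrow> primitive (-1) \<omega> Q \<Longrightarrow>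
    \<exists>T0 T1. (Q \<longlongrightarrow> T0) (at_right 0) \<and> (Q \<longlongrightarrow> T1) at_top \<and> norm (T1 - T0) \<le> K / \<omega>"
proof -
  define K where "K = 2 * wconst / (Re z + 1) + 2 * wconst / (real k - Re z)"
  show ?thesis
  proof (rule that[of K])
    fix \<omega> Q assume \<omega>: "\<omega> > 0" and Q: "primitive (-1) \<omega> Q"
    have w: "norm (weight' (-1) s) \<le> wconst * (s powr Re z / (s ^ (k + 1) + 1))" if "s > 0" for s
    proof -
      have "s ^ (k + 1) + 1 > 0" using zero_less_power[OF that, of "k + 1"] by linarith
      then show ?thesis
        using norm_weight'_le[of s "-1"] that by (simp add: power2_eq_square)
    qed
    have pw: "s ^ (k + 1) \<noteq> -1" if "s > 0" for s :: real
      using zero_less_power[OF that, of "k + 1"] by linarith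
    define \<Phi>0 where "\<Phi>0 s = wconst * (s powr (Re z + 1) / (Re z + 1))" for s
    have "\<exists>T. (Q \<longlongrightarrow> T) (at_right 0) \<and> norm (T - Q 1) \<le> 2 * \<bar>0 - \<Phi>0 1\<bar> / \<omega>"
    proof (rule primitive_tail[OF Q \<omega>, where I = "{0<..}"])
      show "(\<Phi>0 has_real_derivative wconst * s powr Re z) (at s)" if "s \<in> {0<..}" for s
        unfolding \<Phi>0_def using that z by (auto intro!: derivative_eq_intros)
      show "norm (weight' (-1) s) \<le> wconst * s powr Re z" if "s \<in> {0<..}" for s
      proof -
        have "s powr Re z / (s ^ (k + 1) + 1) \<le> s powr Re z / 1"
          using that by (intro divide_left_mono) (auto intro!: mult_pos_pos add_pos_pos)
        then have "wconst * (s powr Re z / (s ^ (k + 1) + 1)) \<le> wconst * s powr Re z"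
          using wconst_pos by (intro mult_left_mono) auto
        then show ?thesis using w[of s] that by auto
      qed
      show "(weight (-1) \<longlongrightarrow> 0) (at_right 0)" by (rule weight_tendsto_0_at_right) simp
      show "(\<Phi>0 \<longlongrightarrow> 0) (at_right 0)"
        unfolding \<Phi>0_def[abs_def]
        by (rule tendsto_mult_right_zero tendsto_divide_zero powr_at_right_0)+ (use z in simp)
    qed (use pw in \<open>auto simp: eventually_at_right_less convex_real_interval\<close>)
    then obtain T0 where T0: "(Q \<longlongrightarrow> T0) (at_right 0)" "norm (T0 - Q 1) \<le> 2 * wconst / (Re z + 1) / \<omega>"
      using wconst_pos z by (auto simp: \<Phi>0_def abs_mult)
    define \<Phi>1 where "\<Phi>1 s = wconst * (s powr (Re z - real k) / (Re z - real k))" for s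
    have "\<exists>T. (Q \<longlongrightarrow> T) at_top \<and> norm (T - Q 1) \<le> 2 * \<bar>0 - \<Phi>1 1\<bar> / \<omega>"
    proof (rule primitive_tail[OF Q \<omega>, where I = "{0<..}"])
      show "(\<Phi>1 has_real_derivative wconst * s powr (Re z - real k - 1)) (at s)" if "s \<in> {0<..}" for s
        unfolding \<Phi>1_def using that z by (auto intro!: derivative_eq_intros)
      show "norm (weight' (-1) s) \<le> wconst * s powr (Re z - real k - 1)" if "s \<in> {0<..}" for s
      proof -
        have "s powr Re z / (s ^ (k + 1) + 1) \<le> s powr Re z / s ^ (k + 1)"
          using that by (intro divide_left_mono) (auto intro!: mult_pos_pos add_pos_pos)
        also have "\<dots> = s powr (Re z - real (k + 1))"
          using that by (subst powr_diff) (simp add: powr_realpow del: of_nat_Suc of_nat_add)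
        also have "Re z - real (k + 1) = Re z - real k - 1" by simp
        finally have "wconst * (s powr Re z / (s ^ (k + 1) + 1)) \<le> wconst * s powr (Re z - real k - 1)"
          using wconst_pos by (intro mult_left_mono) auto
        then show ?thesis using w[of s] that by auto
      qed
      show "(weight (-1) \<longlongrightarrow> 0) at_top" by (rule weight_tendsto_0_at_top) simp
      show "(\<Phi>1 \<longlongrightarrow> 0) at_top"
        unfolding \<Phi>1_def[abs_def]
        by (rule tendsto_mult_right_zero tendsto_divide_zero powr_at_top_neg)+ (use z in simp)
    qed (use pw in \<open>auto simp: eventually_gt_at_top convex_real_interval\<close>)
    then obtain T1 where T1: "(Q \<longlongrightarrow> T1) at_top" "norm (T1 - Q 1) \<le> 2 * wconst / (real k - Re z) / \<omega>"
      using wconst_pos z by (auto simp: \<Phi>1_def abs_mult)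
    have "norm (T1 - T0) \<le> norm (T1 - Q 1) + norm (T0 - Q 1)"
      using norm_triangle_ineq4[of "T1 - Q 1" "T0 - Q 1"] by simp
    also have "\<dots> \<le> K / \<omega>"
      using T0(2) T1(2) by (simp add: K_def add_divide_distrib)
    finally show "\<exists>T0 T1. (Q \<longlongrightarrow> T0) (at_right 0) \<and> (Q \<longlongrightarrow> T1) at_top \<and> norm (T1 - T0) \<le> K / \<omega>"
      using T0(1) T1(1) by blast
  qed
qed

text \<open>Two effects compete on (0, 1): the power \<open>s powr Re z\<close> at 0 and the double
  pole at 1. The majorant has one term for each, and integrating the pole up to
  \<open>1 - \<delta>\<close> gives the factor 1/\<delta>.\<close>

lemma stationary_tail_0:
  obtains K where "K \<ge> 0" "\<And>\<omega> Q \<delta>. \<omega> > 0 \<Longrightarrow> primitive 1 \<omega> Q \<Longrightarrow> 0 < \<delta> \<Longrightarrow> \<delta> < 1 \<Longrightarrow>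
    \<exists>T. (Q \<longlongrightarrow> T) (at_right 0) \<and> norm (T - Q (1 - \<delta>)) \<le> K / (\<omega> * \<delta>)"
proof -
  \<comment> \<open>Bounds \<open>s powr Re z\<close> on [1/2, 1), whatever the sign of
    \<open>Re z\<close>.\<close>
  define M :: real where "M = 2 powr \<bar>Re z\<bar>"
  \<comment> \<open>The outer 4 is a 2 from \<open>primitive_tail\<close> times a 2 from
    \<open>p + 1 \<le> 2\<close>; the inner 4 bounds 1/(1 - s)^2 on (0, 1/2].\<close>
  define K where "K = 4 * wconst * (4 / (Re z + 1) + M)"
  define \<Phi> where "\<Phi> s = 2 * wconst * (4 * s powr (Re z + 1) / (Re z + 1) + M / (1 - s))" for s
  define \<Phi>' where "\<Phi>' s = 2 * wconst * (4 * s powr Re z + M / (1 - s)\<^sup>2)" for s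
  have M: "M > 0" by (simp add: M_def)
  have der: "(\<Phi> has_real_derivative \<Phi>' s) (at s)" if "s \<in> {0<..<1}" for s
  proof -
    have "((\<lambda>s. 4 * s powr (Re z + 1) / (Re z + 1)) has_real_derivative 4 * s powr Re z) (at s)"
      using that z by (auto intro!: derivative_eq_intros)
    moreover have "((\<lambda>s. M / (1 - s)) has_real_derivative M / (1 - s)\<^sup>2) (at s)"
      using that by (auto intro!: derivative_eq_intros simp: power2_eq_square)
    ultimately show ?thesis
      unfolding \<Phi>_def[abs_def] \<Phi>'_def by (intro DERIV_cmult DERIV_add)
  qed
  have bd: "norm (weight' 1 s) \<le> \<Phi>' s" if "s \<in> {0<..<1}" for s
  proof -
    define p where "p = s ^ (k + 1)"
    have s: "0 < s" "s < 1" using that by auto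
    have "p \<le> s ^ 1" unfolding p_def using s by (intro power_decreasing) auto
    then have p: "0 < p" "p \<le> s" using s by (auto simp: p_def)
    have "s powr Re z * (p + 1) / (p - 1)\<^sup>2 \<le> s powr Re z * 2 / (1 - s)\<^sup>2"
    proof (intro frac_le mult_left_mono)
      have "(1 - s)\<^sup>2 \<le> (1 - p)\<^sup>2" using p s by (intro power_mono) auto
      then show "(1 - s)\<^sup>2 \<le> (p - 1)\<^sup>2" by (simp add: power2_commute)
    qed (use p s in auto)
    also have "\<dots> = 2 * (s powr Re z / (1 - s)\<^sup>2)" by simp
    also have "s powr Re z / (1 - s)\<^sup>2 \<le> 4 * s powr Re z + M / (1 - s)\<^sup>2"
    proof (cases "s \<le> 1 / 2")
      case True
      then have "(1 / 2)\<^sup>2 \<le> (1 - s)\<^sup>2" by (intro power_mono) auto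
      then have "s powr Re z / (1 - s)\<^sup>2 \<le> s powr Re z / (1 / 2)\<^sup>2"
        using s by (intro divide_left_mono) auto
      then have "s powr Re z / (1 - s)\<^sup>2 \<le> 4 * s powr Re z" by (simp add: power2_eq_square)
      moreover have "M / (1 - s)\<^sup>2 \<ge> 0" using M by simp
      ultimately show ?thesis by linarith
    next
      case False
      have "s powr Re z \<le> M"
      proof (cases "Re z \<ge> 0")
        case True
        then have "s powr Re z \<le> 1" "1 \<le> M" using s by (auto simp: M_def intro: powr_le1 ge_one_powr_ge_zero)
        then show ?thesis by simp
      next
        case neg: False
        then have "s powr Re z \<le> (1 / 2) powr Re z" using False by (intro powr_mono2') auto
        also have "\<dots> = M" using neg by (simp add: M_def powr_divide powr_minus_divide)
        finally show ?thesis .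
      qed
      then have "s powr Re z / (1 - s)\<^sup>2 \<le> M / (1 - s)\<^sup>2" by (intro divide_right_mono) auto
      moreover have "s powr Re z \<ge> 0" by simp
      ultimately show ?thesis by linarith
    qed
    finally have "s powr Re z * (p + 1) / (p - 1)\<^sup>2 \<le> 2 * (4 * s powr Re z + M / (1 - s)\<^sup>2)" by simp
    then have "wconst * (s powr Re z * (p + 1) / (p - 1)\<^sup>2) \<le> wconst * (2 * (4 * s powr Re z + M / (1 - s)\<^sup>2))"
      using wconst_pos by (intro mult_left_mono) auto
    moreover have "norm (weight' 1 s) \<le> wconst * (s powr Re z * (p + 1) / (p - 1)\<^sup>2)"
      unfolding p_def using s by (intro norm_weight'_le) auto
    moreover have "wconst * (2 * (4 * s powr Re z + M / (1 - s)\<^sup>2)) = \<Phi>' s"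
      unfolding \<Phi>'_def by simp
    ultimately show ?thesis by linarith
  qed
  \<comment> \<open>The limit is not 0, because the antiderivative \<open>M / (1 - s)\<close> of the
    pole term equals \<open>M\<close> at 0; only increments of \<open>\<Phi>\<close> matter.\<close>
  have lim: "(\<Phi> \<longlongrightarrow> 2 * wconst * M) (at_right 0)"
  proof -
    have "((\<lambda>s. 4 * s powr (Re z + 1) / (Re z + 1)) \<longlongrightarrow> 0) (at_right 0)"
      by (rule tendsto_mult_right_zero tendsto_divide_zero powr_at_right_0)+ (use z in simp)
    moreover have "((\<lambda>s. M / (1 - s)) \<longlongrightarrow> M / (1 - 0)) (at_right 0)"
      by (intro tendsto_intros) auto
    ultimately have "((\<lambda>s. 2 * wconst * (4 * s powr (Re z + 1) / (Re z + 1) + M / (1 - s))) \<longlongrightarrow>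
        2 * wconst * (0 + M / (1 - 0))) (at_right 0)"
      by (intro tendsto_mult tendsto_add tendsto_const)
    then show ?thesis by (simp add: \<Phi>_def[abs_def])
  qed
  show ?thesis
  proof (rule that[of K])
    show "K \<ge> 0" using wconst_pos M z by (simp add: K_def)
    fix \<omega> Q \<delta> assume \<omega>: "\<omega> > 0" and Q: "primitive 1 \<omega> Q" and \<delta>: "0 < \<delta>" "\<delta> < (1::real)"
    have "\<exists>T. (Q \<longlongrightarrow> T) (at_right 0) \<and> norm (T - Q (1 - \<delta>)) \<le> 2 * \<bar>2 * wconst * M - \<Phi> (1 - \<delta>)\<bar> / \<omega>"
    proof (rule primitive_tail[OF Q \<omega>, where I = "{0<..<1}"])
      show "eventually (\<lambda>x. x \<in> {0<..<1::real}) (at_right 0)"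
        by (rule eventually_at_rightI[of 0 1]) auto
      show "s ^ (k + 1) \<noteq> 1" if "s \<in> {0<..<1}" for s :: real
        using power_strict_decreasing[of 0 "k + 1" s] that by auto
    qed (use der bd lim \<delta> in \<open>auto intro!: weight_tendsto_0_at_right simp: convex_real_interval\<close>)
    then obtain T where T: "(Q \<longlongrightarrow> T) (at_right 0)"
      "norm (T - Q (1 - \<delta>)) \<le> 2 * \<bar>2 * wconst * M - \<Phi> (1 - \<delta>)\<bar> / \<omega>" by blast
    have "(1 - \<delta>) powr (Re z + 1) \<le> 1 powr (Re z + 1)"
      using \<delta> z by (intro powr_mono2) auto
    then have "4 * (1 - \<delta>) powr (Re z + 1) / (Re z + 1) \<le> 4 / (Re z + 1)"
      using z by (intro divide_right_mono) auto
    also have "\<dots> \<le> 4 / (Re z + 1) / \<delta>"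
      using divide_left_mono[of \<delta> 1 "4 / (Re z + 1)"] \<delta> z by simp
    finally have "4 * (1 - \<delta>) powr (Re z + 1) / (Re z + 1) + M / \<delta> \<le> (4 / (Re z + 1) + M) / \<delta>"
      by (simp add: add_divide_distrib)
    then have "\<Phi> (1 - \<delta>) \<le> 2 * wconst * ((4 / (Re z + 1) + M) / \<delta>)"
      unfolding \<Phi>_def using wconst_pos by (intro mult_left_mono) auto
    moreover have "2 * wconst * M \<le> \<Phi> (1 - \<delta>)"
    proof -
      have "M * 1 \<le> M * (1 / \<delta>)" using M \<delta> by (intro mult_left_mono) auto
      moreover have "4 * (1 - \<delta>) powr (Re z + 1) / (Re z + 1) \<ge> 0" using z by auto
      ultimately have "M \<le> 4 * (1 - \<delta>) powr (Re z + 1) / (Re z + 1) + M / \<delta>" by simp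
      then show ?thesis unfolding \<Phi>_def using wconst_pos by (intro mult_left_mono) auto
    qed
    moreover have "2 * wconst * M \<ge> 0" using wconst_pos M by simp
    ultimately have "\<bar>2 * wconst * M - \<Phi> (1 - \<delta>)\<bar> \<le> 2 * wconst * ((4 / (Re z + 1) + M) / \<delta>)"
      by linarith
    then have "2 * \<bar>2 * wconst * M - \<Phi> (1 - \<delta>)\<bar> / \<omega> \<le> 2 * (2 * wconst * ((4 / (Re z + 1) + M) / \<delta>)) / \<omega>"
      using \<omega> by (intro divide_right_mono mult_left_mono) auto
    also have "\<dots> = K / (\<omega> * \<delta>)" by (simp add: K_def mult_ac)
    finally show "\<exists>T. (Q \<longlongrightarrow> T) (at_right 0) \<and> norm (T - Q (1 - \<delta>)) \<le> K / (\<omega> * \<delta>)"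
      using T order_trans by blast
  qed
qed

text \<open>With \<open>p = s ^ (k + 1)\<close> and the decaying power \<open>r\<close> taken out,
  what remains of the bound on \<open>weight'\<close> is the square of \<open>p / (p - 1)\<close>.
  This quotient is at most s/(s - 1), which shows the pole at 1 and stays bounded at
  infinity.\<close>

lemma stationary_tail_top:
  obtains K where "K \<ge> 0" "\<And>\<omega> Q \<delta>. \<omega> > 0 \<Longrightarrow> primitive 1 \<omega> Q \<Longrightarrow> 0 < \<delta> \<Longrightarrow> \<delta> < 1 \<Longrightarrow>
    \<exists>T. (Q \<longlongrightarrow> T) at_top \<and> norm (T - Q (1 + \<delta>)) \<le> K / (\<omega> * \<delta>)"
proof -
  \<comment> \<open>The 8 collects three factors 2: from \<open>primitive_tail\<close>, from
    \<open>p + 1 \<le> 2 * p\<close>, and from (1 + x)^2 \<le> 2 (1 + x^2).\<close>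
  define K where "K = 8 * wconst * (1 / (real k - Re z) + 1)"
  define \<Phi> where "\<Phi> s = 4 * wconst * (s powr (Re z - real k) / (Re z - real k) - 1 / (s - 1))" for s
  define \<Phi>' where "\<Phi>' s = 4 * wconst * (s powr (Re z - real k - 1) + 1 / (s - 1)\<^sup>2)" for s
  have der: "(\<Phi> has_real_derivative \<Phi>' s) (at s)" if "s \<in> {1<..}" for s
  proof -
    have "((\<lambda>s. s powr (Re z - real k) / (Re z - real k)) has_real_derivative s powr (Re z - real k - 1)) (at s)"
      using that z by (auto intro!: derivative_eq_intros)
    moreover have "((\<lambda>s. 1 / (s - 1)) has_real_derivative - (1 / (s - 1)\<^sup>2)) (at s)"
      using that by (auto intro!: derivative_eq_intros simp: power2_eq_square)
    ultimately have "(\<Phi> has_real_derivative 4 * wconst * (s powr (Re z - real k - 1) - (- (1 / (s - 1)\<^sup>2)))) (at s)"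
      unfolding \<Phi>_def[abs_def] by (intro DERIV_cmult DERIV_diff)
    then show ?thesis by (simp add: \<Phi>'_def)
  qed
  have bd: "norm (weight' 1 s) \<le> \<Phi>' s" if "s \<in> {1<..}" for s
  proof -
    define p where "p = s ^ (k + 1)"
    define r where "r = s powr (Re z - real k - 1)"
    have s: "1 < s" using that by auto
    have "1 \<le> s ^ k" using s by simp
    \<comment> \<open>The two sides of the second inequality differ by
      \<open>s ^ k - 1\<close>.\<close>
    then have p: "p > 1" "p - 1 \<ge> s ^ k * (s - 1)"
      using s by (auto simp: p_def algebra_simps less_1_mult' one_less_power)
    have r: "0 < r" "r \<le> 1"
      using s z powr_mono[of "Re z - real k - 1" 0 s] by (auto simp: r_def)
    have rp: "s powr Re z = r * p"
    proof -
      have "s powr Re z = s powr ((Re z - real k - 1) + real (k + 1))" by simp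
      also have "\<dots> = r * p"
        unfolding r_def p_def using s by (subst powr_add) (simp add: powr_realpow del: of_nat_Suc of_nat_add)
      finally show ?thesis .
    qed
    have "p / (p - 1) \<le> s ^ k * s / (s ^ k * (s - 1))"
      using p s by (intro frac_le) (auto simp: p_def)
    also have "\<dots> = 1 + 1 / (s - 1)"
      using s by (simp add: field_simps)
    finally have "(p / (p - 1))\<^sup>2 \<le> (1 + 1 / (s - 1))\<^sup>2"
      using p by (intro power_mono) auto
    also have "\<dots> \<le> 2 * (1 + 1 / (s - 1)\<^sup>2)"
      using sum_squares_bound[of 1 "1 / (s - 1)"] by (simp add: power2_sum power_divide)
    finally have q: "(p / (p - 1))\<^sup>2 \<le> 2 * (1 + 1 / (s - 1)\<^sup>2)" .
    have "s powr Re z * (p + 1) / (p - 1)\<^sup>2 \<le> r * p * (2 * p) / (p - 1)\<^sup>2"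
      unfolding rp using p r by (intro divide_right_mono mult_left_mono) auto
    also have "\<dots> = 2 * r * (p / (p - 1))\<^sup>2" by (simp add: power2_eq_square)
    also have "\<dots> \<le> 2 * r * (2 * (1 + 1 / (s - 1)\<^sup>2))"
      using q r by (intro mult_left_mono) auto
    also have "\<dots> = 4 * (r + r * (1 / (s - 1)\<^sup>2))" by (simp add: algebra_simps)
    \<comment> \<open>\<open>r\<close> stays where it alone provides decay at infinity; next to the
      pole term, which decays by itself, it is replaced by 1.\<close>
    also have "\<dots> \<le> 4 * (r + 1 * (1 / (s - 1)\<^sup>2))"
      using r by (intro mult_left_mono add_left_mono mult_right_mono) auto
    finally have "wconst * (s powr Re z * (p + 1) / (p - 1)\<^sup>2) \<le> wconst * (4 * (r + 1 / (s - 1)\<^sup>2))"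
      using wconst_pos by (intro mult_left_mono) auto
    moreover have "norm (weight' 1 s) \<le> wconst * (s powr Re z * (p + 1) / (p - 1)\<^sup>2)"
      unfolding p_def using s by (intro norm_weight'_le) auto
    moreover have "wconst * (4 * (r + 1 / (s - 1)\<^sup>2)) = \<Phi>' s"
      unfolding \<Phi>'_def r_def by simp
    ultimately show ?thesis by linarith
  qed
  have lim: "(\<Phi> \<longlongrightarrow> 0) at_top"
  proof -
    have "((\<lambda>s. s powr (Re z - real k) / (Re z - real k)) \<longlongrightarrow> 0) at_top"
      by (rule tendsto_mult_right_zero tendsto_divide_zero powr_at_top_neg)+ (use z in simp)
    moreover have "((\<lambda>s::real. 1 / (s - 1)) \<longlongrightarrow> 0) at_top" by real_asymp
    ultimately have "((\<lambda>s. 4 * wconst * (s powr (Re z - real k) / (Re z - real k) - 1 / (s - 1))) \<longlongrightarrow>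
        4 * wconst * (0 - 0)) at_top"
      by (intro tendsto_mult tendsto_diff tendsto_const)
    then show ?thesis by (simp add: \<Phi>_def[abs_def])
  qed
  show ?thesis
  proof (rule that[of K])
    show "K \<ge> 0" using wconst_pos z by (simp add: K_def)
    fix \<omega> Q \<delta> assume \<omega>: "\<omega> > 0" and Q: "primitive 1 \<omega> Q" and \<delta>: "0 < \<delta>" "\<delta> < (1::real)"
    have "\<exists>T. (Q \<longlongrightarrow> T) at_top \<and> norm (T - Q (1 + \<delta>)) \<le> 2 * \<bar>0 - \<Phi> (1 + \<delta>)\<bar> / \<omega>"
    proof (rule primitive_tail[OF Q \<omega>, where I = "{1<..}"])
      show "s ^ (k + 1) \<noteq> 1" if "s \<in> {1<..}" for s :: real
        using one_less_power[of s "k + 1"] that by auto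
    qed (use der bd lim \<delta> in \<open>auto intro!: weight_tendsto_0_at_top simp: convex_real_interval eventually_gt_at_top\<close>)
    then obtain T where T: "(Q \<longlongrightarrow> T) at_top"
      "norm (T - Q (1 + \<delta>)) \<le> 2 * \<bar>0 - \<Phi> (1 + \<delta>)\<bar> / \<omega>" by blast
    define r where "r = (1 + \<delta>) powr (Re z - real k)"
    have r: "0 < r" "r \<le> 1"
      using \<delta> z powr_mono[of "Re z - real k" 0 "1 + \<delta>"] by (auto simp: r_def)
    have \<Phi>: "- \<Phi> (1 + \<delta>) = 4 * wconst * (r / (real k - Re z) + 1 / \<delta>)"
      using z \<delta> by (simp add: \<Phi>_def r_def field_simps)
    have "r / (real k - Re z) \<le> 1 / (real k - Re z)"
      using r z by (intro divide_right_mono) auto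
    also have "\<dots> \<le> 1 / (real k - Re z) / \<delta>"
      using divide_left_mono[of \<delta> 1 "1 / (real k - Re z)"] \<delta> z by simp
    finally have "r / (real k - Re z) + 1 / \<delta> \<le> (1 / (real k - Re z) + 1) / \<delta>"
      by (simp add: add_divide_distrib)
    then have "- \<Phi> (1 + \<delta>) \<le> 4 * wconst * ((1 / (real k - Re z) + 1) / \<delta>)"
      unfolding \<Phi> using wconst_pos by (intro mult_left_mono) auto
    moreover have "- \<Phi> (1 + \<delta>) \<ge> 0"
      unfolding \<Phi> using wconst_pos r z \<delta> by (intro mult_nonneg_nonneg add_nonneg_nonneg) auto
    ultimately have "\<bar>0 - \<Phi> (1 + \<delta>)\<bar> \<le> 4 * wconst * ((1 / (real k - Re z) + 1) / \<delta>)"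
      by linarith
    then have "2 * \<bar>0 - \<Phi> (1 + \<delta>)\<bar> / \<omega> \<le> 2 * (4 * wconst * ((1 / (real k - Re z) + 1) / \<delta>)) / \<omega>"
      using \<omega> by (intro divide_right_mono mult_left_mono) auto
    also have "\<dots> = K / (\<omega> * \<delta>)" by (simp add: K_def mult_ac)
    finally show "\<exists>T. (Q \<longlongrightarrow> T) at_top \<and> norm (T - Q (1 + \<delta>)) \<le> K / (\<omega> * \<delta>)"
      using T order_trans by blast
  qed
qed

section \<open>The neighbourhood of the critical point\<close>

text \<open>The linear term is missing because 1 is critical. The range keeps a distance of 1/2 from
  the singularity at 0, so the third derivative is bounded on it.\<close>

lemma phase_taylor:
  obtains B where "B \<ge> 0" "\<And>s. s \<in> {1/2..3/2} \<Longrightarrow>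
    \<bar>phase 1 s - (real k + 1 + real k * (real k + 1) / 2 * (s - 1)\<^sup>2)\<bar> \<le> B * \<bar>s - 1\<bar> ^ 3"
proof -
  \<comment> \<open>The absolute value of the third derivative at 1/2, its maximum on the range; the
    division by 3! is given away.\<close>
  define B where "B = real k * (real k + 1) * (real k + 2) * 2 ^ (k + 3)"
  define D where "D m = (if m = 0 then phase 1 else if m = 1 then (\<lambda>s. real k - real k / s ^ (k + 1))
    else if m = 2 then (\<lambda>s. real k * (real k + 1) / s ^ (k + 2))
    else (\<lambda>s. - (real k * (real k + 1) * (real k + 2)) / s ^ (k + 3)))" for m :: nat
  have inv: "((\<lambda>s. c / s ^ n) has_real_derivative - (c * real n) / s ^ (n + 1)) (at s)"
    if "s > 0" "n > 0" for c s :: real and n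
  proof -
    have "((\<lambda>s. c / s ^ n) has_real_derivative (0 * s ^ n - c * (real n * s ^ (n - Suc 0))) / (s ^ n * s ^ n)) (at s)"
      using that by (intro DERIV_divide DERIV_const DERIV_pow) auto
    moreover have "s ^ n = s * s ^ (n - Suc 0)"
      using that by (cases n) auto
    ultimately show ?thesis
      using that by (elim DERIV_cong) (simp add: field_simps)
  qed
  have der: "(D m has_real_derivative D (Suc m) s) (at s)" if "m < 3" "1/2 \<le> s" for m s
  proof -
    have s: "s > 0" using that by simp
    have "m = 0 \<or> m = 1 \<or> m = 2" using that(1) by auto
    then consider "m = 0" | "m = 1" | "m = 2" by blast
    then show ?thesis
    proof cases
      case 1
      have "phase' 1 s = real k - real k / s ^ (k + 1)"
        using s by (simp add: phase'_def field_simps)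
      then show ?thesis
        using has_real_derivative_phase[OF s, of 1] 1 by (simp add: D_def)
    next
      case 2
      have "((\<lambda>s. real k - real k / s ^ (k + 1)) has_real_derivative
          0 - - (real k * real (k + 1)) / s ^ (k + 1 + 1)) (at s)"
        using s by (intro DERIV_diff DERIV_const inv) auto
      then show ?thesis using 2 by (simp add: D_def add.commute)
    next
      case 3
      then show ?thesis
        using inv[OF s, of "k + 2" "real k * (real k + 1)"] by (simp add: D_def numeral_3_eq_3 add.commute)
    qed
  qed
  show ?thesis
  proof (rule that[of B])
    show "B \<ge> 0" by (simp add: B_def)
    fix s :: real assume s: "s \<in> {1/2..3/2}"
    show "\<bar>phase 1 s - (real k + 1 + real k * (real k + 1) / 2 * (s - 1)\<^sup>2)\<bar> \<le> B * \<bar>s - 1\<bar> ^ 3"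
    proof (cases "s = 1")
      case True
      then show ?thesis by (simp add: phase_def)
    next
      case False
      have "\<exists>t. (if s < 1 then s < t \<and> t < 1 else 1 < t \<and> t < s) \<and>
          phase 1 s = (\<Sum>m<3. D m 1 / fact m * (s - 1) ^ m) + D 3 t / fact 3 * (s - 1) ^ 3"
        by (rule Taylor[of 3 D _ "1/2" "3/2"]) (use der s False in \<open>auto simp: D_def\<close>)
      then obtain t where t: "if s < 1 then s < t \<and> t < 1 else 1 < t \<and> t < s"
        "phase 1 s = (\<Sum>m<3. D m 1 / fact m * (s - 1) ^ m) + D 3 t / fact 3 * (s - 1) ^ 3" by blast
      have t2: "t \<ge> 1/2" using t(1) s by (auto split: if_splits)
      have "(\<Sum>m<3. D m 1 / fact m * (s - 1) ^ m) = real k + 1 + real k * (real k + 1) / 2 * (s - 1)\<^sup>2"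
        by (simp add: eval_nat_numeral D_def phase_def)
      then have e: "phase 1 s - (real k + 1 + real k * (real k + 1) / 2 * (s - 1)\<^sup>2) = D 3 t / 6 * (s - 1) ^ 3"
        using t(2) by (simp add: fact_numeral)
      have "\<bar>D 3 t\<bar> = real k * (real k + 1) * (real k + 2) / t ^ (k + 3)"
        using t2 by (simp add: D_def abs_divide abs_mult)
      also have "\<dots> \<le> real k * (real k + 1) * (real k + 2) / (1 / 2) ^ (k + 3)"
        using t2 by (intro divide_left_mono power_mono mult_nonneg_nonneg mult_pos_pos) auto
      also have "\<dots> = B" by (simp add: B_def power_one_over)
      finally have "\<bar>D 3 t / 6\<bar> \<le> B" using \<open>B \<ge> 0\<close> by simp
      then show ?thesis
        unfolding e abs_mult power_abs by (intro mult_right_mono) auto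
    qed
  qed
qed

text \<open>The power is replaced by its value 1 at the critical point, with an error of order
  \<delta>, and the phase by its Taylor polynomial, with an error of order \<omega> \<delta>^3 as
  cos is 1-Lipschitz. The length 2 \<delta> of the interval supplies one more power of \<delta> in
  each.\<close>

lemma stationary_middle:
  obtains K where "K \<ge> 0" "\<And>\<omega> Q \<delta>. \<omega> > 0 \<Longrightarrow> primitive 1 \<omega> Q \<Longrightarrow> 0 < \<delta> \<Longrightarrow> \<delta> \<le> 1/2 \<Longrightarrow>
    norm (Q (1 + \<delta>) - Q (1 - \<delta>) - of_real (integral {1 - \<delta>..1 + \<delta>}
      (\<lambda>s. cos (\<omega> * (real k + 1) + \<omega> * (real k * (real k + 1) / 2) * (s - 1)\<^sup>2)))) \<le> K * (\<delta>\<^sup>2 + \<omega> * \<delta> ^ 4)"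
proof -
  obtain B where B: "B \<ge> 0" "\<And>s. s \<in> {1/2..3/2} \<Longrightarrow>
    \<bar>phase 1 s - (real k + 1 + real k * (real k + 1) / 2 * (s - 1)\<^sup>2)\<bar> \<le> B * \<bar>s - 1\<bar> ^ 3"
    using phase_taylor by blast
  define g where "g s = complex_of_real s powr (z - of_nat k)" for s
  \<comment> \<open>Bounds the derivative of \<open>g\<close>: the exponent
    \<open>Re z - real k - 1\<close> is negative, so the left end 1/2 is the worst point.\<close>
  define G where "G = norm (z - of_nat k) * (1 / 2) powr (Re z - real k - 1)"
  have G: "G \<ge> 0" by (simp add: G_def)
  have g: "norm (g s - 1) \<le> G * \<bar>s - 1\<bar>" if "s \<in> {1/2..3/2}" for s
  proof -
    have "norm (g s - g 1) \<le> \<bar>G * s - G * 1\<bar>"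
    proof (rule norm_diff_le_abs_diff[where I = "{1/2..3/2}" and f = g and \<Phi> = "\<lambda>x. G * x"
          and f' = "\<lambda>x. (z - of_nat k) * of_real x powr (z - of_nat k - 1)" and \<Phi>' = "\<lambda>_. G"])
      fix x :: real assume x: "x \<in> {1/2..3/2}"
      then show "(g has_vector_derivative (z - of_nat k) * of_real x powr (z - of_nat k - 1)) (at x)"
        unfolding g_def[abs_def] by (intro has_vector_derivative_of_real_powr) auto
      have "norm ((z - of_nat k) * of_real x powr (z - of_nat k - 1)) =
          norm (z - of_nat k) * x powr (Re z - real k - 1)"
        using x by (subst norm_mult, subst norm_of_real_powr) auto
      also have "\<dots> \<le> G"
        unfolding G_def using x z by (intro mult_left_mono powr_mono2') auto
      finally show "norm ((z - of_nat k) * of_real x powr (z - of_nat k - 1)) \<le> G" .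
    qed (use that in \<open>auto intro!: derivative_eq_intros\<close>)
    also have "\<dots> = G * \<bar>s - 1\<bar>"
      using G unfolding right_diff_distrib[symmetric] abs_mult by simp
    finally show ?thesis by (simp add: g_def)
  qed
  define K where "K = 2 * (G + B)"
  show ?thesis
  proof (rule that[of K])
    show "K \<ge> 0" using G B by (simp add: K_def)
    fix \<omega> Q \<delta> assume \<omega>: "\<omega> > 0" and Q: "primitive 1 \<omega> Q" and \<delta>: "0 < \<delta>" "\<delta> \<le> (1/2 :: real)"
    define m where "m s = cos (\<omega> * (real k + 1) + \<omega> * (real k * (real k + 1) / 2) * (s - 1)\<^sup>2)" for s
    have "((\<lambda>s. g s * of_real (cos (\<omega> * phase 1 s))) has_integral Q (1 + \<delta>) - Q (1 - \<delta>)) {1 - \<delta>..1 + \<delta>}"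
    proof (rule fundamental_theorem_of_calculus)
      fix s assume "s \<in> {1 - \<delta>..1 + \<delta>}"
      then have "s > 0" using \<delta> by auto
      then show "(Q has_vector_derivative g s * of_real (cos (\<omega> * phase 1 s))) (at s within {1 - \<delta>..1 + \<delta>})"
        using Q unfolding primitive_def g_def by (blast intro: has_vector_derivative_at_within)
    qed (use \<delta> in auto)
    moreover have "(m has_integral integral {1 - \<delta>..1 + \<delta>} m) {1 - \<delta>..1 + \<delta>}"
      unfolding m_def[abs_def] by (intro integrable_integral integrable_continuous_interval continuous_intros)
    then have "((\<lambda>s. complex_of_real (m s)) has_integral of_real (integral {1 - \<delta>..1 + \<delta>} m)) {1 - \<delta>..1 + \<delta>}"
      by (rule has_integral_of_real)
    ultimately have i: "((\<lambda>s. g s * of_real (cos (\<omega> * phase 1 s)) - of_real (m s)) has_integral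
        Q (1 + \<delta>) - Q (1 - \<delta>) - of_real (integral {1 - \<delta>..1 + \<delta>} m)) {1 - \<delta>..1 + \<delta>}"
      by (rule has_integral_diff)
    have bound: "norm (g s * of_real (cos (\<omega> * phase 1 s)) - of_real (m s)) \<le> G * \<delta> + \<omega> * B * \<delta> ^ 3"
      if s: "s \<in> {1 - \<delta>..1 + \<delta>}" for s
    proof -
      have s': "s \<in> {1/2..3/2}" "\<bar>s - 1\<bar> \<le> \<delta>" using s \<delta> by auto
      have "norm (g s * of_real (cos (\<omega> * phase 1 s)) - of_real (m s)) =
          norm ((g s - 1) * of_real (cos (\<omega> * phase 1 s)) + of_real (cos (\<omega> * phase 1 s) - m s))"
        by (simp add: algebra_simps)
      also have "\<dots> \<le> norm ((g s - 1) * of_real (cos (\<omega> * phase 1 s))) +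
          norm (complex_of_real (cos (\<omega> * phase 1 s) - m s))"
        by (rule norm_triangle_ineq)
      also have "\<dots> = norm (g s - 1) * \<bar>cos (\<omega> * phase 1 s)\<bar> + \<bar>cos (\<omega> * phase 1 s) - m s\<bar>"
        by (simp only: norm_mult norm_of_real)
      finally have 1: "norm (g s * of_real (cos (\<omega> * phase 1 s)) - of_real (m s)) \<le>
          norm (g s - 1) * \<bar>cos (\<omega> * phase 1 s)\<bar> + \<bar>cos (\<omega> * phase 1 s) - m s\<bar>" .
      have 2: "norm (g s - 1) * \<bar>cos (\<omega> * phase 1 s)\<bar> \<le> G * \<delta> * 1"
      proof (rule mult_mono)
        have "G * \<bar>s - 1\<bar> \<le> G * \<delta>" using G s' by (intro mult_left_mono) auto
        then show "norm (g s - 1) \<le> G * \<delta>" using g[OF s'(1)] by simp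
      qed (use G \<delta> in auto)
      have "B * \<bar>s - 1\<bar> ^ 3 \<le> B * \<delta> ^ 3" using B(1) s' by (intro mult_left_mono power_mono) auto
      then have 3: "\<bar>\<omega>\<bar> * \<bar>phase 1 s - (real k + 1 + real k * (real k + 1) / 2 * (s - 1)\<^sup>2)\<bar> \<le> \<omega> * (B * \<delta> ^ 3)"
        using \<omega> B(2)[OF s'(1)] by (intro mult_mono) auto
      have "\<bar>cos (\<omega> * phase 1 s) - m s\<bar> \<le>
          \<bar>\<omega> * phase 1 s - (\<omega> * (real k + 1) + \<omega> * (real k * (real k + 1) / 2) * (s - 1)\<^sup>2)\<bar>"
        unfolding m_def by (rule abs_cos_diff_le)
      also have "\<omega> * phase 1 s - (\<omega> * (real k + 1) + \<omega> * (real k * (real k + 1) / 2) * (s - 1)\<^sup>2) =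
          \<omega> * (phase 1 s - (real k + 1 + real k * (real k + 1) / 2 * (s - 1)\<^sup>2))"
        by (simp add: algebra_simps)
      finally have "\<bar>cos (\<omega> * phase 1 s) - m s\<bar> \<le> \<omega> * (B * \<delta> ^ 3)"
        using 3 unfolding abs_mult by (rule order_trans)
      with 1 2 show ?thesis by (simp only: mult.assoc mult_1_right)
    qed
    have "norm (Q (1 + \<delta>) - Q (1 - \<delta>) - of_real (integral {1 - \<delta>..1 + \<delta>} m)) \<le>
        (G * \<delta> + \<omega> * B * \<delta> ^ 3) * measure lborel {1 - \<delta>..1 + \<delta>}"
      by (rule has_integral_bound_real[OF _ finite.emptyI i]) (use bound G B \<omega> \<delta> in auto)
    also have "\<dots> = 2 * G * \<delta>\<^sup>2 + 2 * B * (\<omega> * \<delta> ^ 4)"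
      using \<delta> by (simp add: eval_nat_numeral algebra_simps)
    also have "\<dots> \<le> K * \<delta>\<^sup>2 + K * (\<omega> * \<delta> ^ 4)"
      using G B \<omega> by (intro add_mono mult_right_mono) (auto simp: K_def)
    finally show "norm (Q (1 + \<delta>) - Q (1 - \<delta>) - of_real (integral {1 - \<delta>..1 + \<delta>}
      (\<lambda>s. cos (\<omega> * (real k + 1) + \<omega> * (real k * (real k + 1) / 2) * (s - 1)\<^sup>2)))) \<le> K * (\<delta>\<^sup>2 + \<omega> * \<delta> ^ 4)"
      unfolding m_def[abs_def] distrib_left[of K] .
  qed
qed

section \<open>Assembling the asymptotics of the scaled integral\<close>

lemma primitive_exists:
  obtains Q where "primitive e \<omega> Q"
proof -
  have "isCont (\<lambda>s. complex_of_real s powr (z - of_nat k) * of_real (cos (\<omega> * phase e s))) s" if "s > 0" for s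
  proof -
    have "isCont (phase e) s"
      using has_real_derivative_phase[OF that] by (rule DERIV_isCont)
    moreover have "isCont (\<lambda>s. complex_of_real s powr (z - of_nat k)) s"
      using has_vector_derivative_of_real_powr[OF that] by (rule has_vector_derivative_continuous)
    moreover have "isCont (\<lambda>s. complex_of_real (cos (\<omega> * phase e s))) s"
      using \<open>isCont (phase e) s\<close> by (intro continuous_of_real isCont_cos' isCont_mult continuous_const)
    ultimately show ?thesis by (intro isCont_mult)
  qed
  then have "\<exists>Q. \<forall>s::real. 0 < ereal s \<longrightarrow> ereal s < \<infinity> \<longrightarrow> (Q has_vector_derivative
      complex_of_real s powr (z - of_nat k) * of_real (cos (\<omega> * phase e s))) (at s)"
    by (intro einterval_antiderivative) auto
  then obtain Q where "\<And>s::real. 0 < s \<Longrightarrow> (Q has_vector_derivative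
      complex_of_real s powr (z - of_nat k) * of_real (cos (\<omega> * phase e s))) (at s)"
    by auto
  then have "primitive e \<omega> Q" by (simp add: primitive_def)
  then show ?thesis by (rule that)
qed

text \<open>\<open>Lim\<close> alone claims no convergence; for positive \<omega> that is
  \<open>scaled_integral_tendsto\<close>.\<close>

definition scaled_integral :: "real \<Rightarrow> complex" where
  "scaled_integral \<omega> = Lim (at_right 0 \<times>\<^sub>F at_top) (\<lambda>(a, b). integral {a..b}
     (\<lambda>s. of_real s powr (z - of_nat k) * of_real (cos (\<omega> * (real k * s))) * of_real (cos (\<omega> / s ^ k))))"

text \<open>By the product-to-sum formula each proper integral is half the sum of the increments of
  \<open>P\<close> and \<open>Q\<close>. These separate the two endpoints, so the one-sided limits
  give the joint limit in a and b.\<close>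

lemma tendsto_of_primitives:
  assumes p: "primitive 1 \<omega> P" and q: "primitive (-1) \<omega> Q"
    and P: "(P \<longlongrightarrow> P0) (at_right 0)" "(P \<longlongrightarrow> P1) at_top"
    and Q: "(Q \<longlongrightarrow> Q0) (at_right 0)" "(Q \<longlongrightarrow> Q1) at_top"
  shows "((\<lambda>(a, b). integral {a..b} (\<lambda>s. of_real s powr (z - of_nat k) *
     of_real (cos (\<omega> * (real k * s))) * of_real (cos (\<omega> / s ^ k)))) \<longlongrightarrow> ((P1 - P0) + (Q1 - Q0)) / 2)
     (at_right 0 \<times>\<^sub>F at_top)"
proof -
  let ?f = "\<lambda>s. complex_of_real s powr (z - of_nat k) * of_real (cos (\<omega> * (real k * s))) * of_real (cos (\<omega> / s ^ k))"
  have int: "integral {a..b} ?f = ((P b - P a) + (Q b - Q a)) / 2" if "0 < a" "a \<le> b" for a b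
  proof -
    let ?g = "\<lambda>e s. complex_of_real s powr (z - of_nat k) * of_real (cos (\<omega> * phase e s))"
    have "(?g e has_integral R b - R a) {a..b}" if "primitive e \<omega> R" for e R
    proof (rule fundamental_theorem_of_calculus[OF \<open>a \<le> b\<close>])
      fix s assume "s \<in> {a..b}"
      with \<open>0 < a\<close> have "s > 0" by simp
      with that show "(R has_vector_derivative ?g e s) (at s within {a..b})"
        unfolding primitive_def by (blast intro: has_vector_derivative_at_within)
    qed
    from has_integral_divide[OF has_integral_add[OF this[OF p] this[OF q]], of 2]
    have "((\<lambda>s. (?g 1 s + ?g (-1) s) / 2) has_integral ((P b - P a) + (Q b - Q a)) / 2) {a..b}" .
    moreover have eq: "(?g 1 s + ?g (-1) s) / 2 = ?f s" for s
    proof -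
      have "cos (\<omega> * (real k * s)) * cos (\<omega> / s ^ k) = (cos (\<omega> * phase 1 s) + cos (\<omega> * phase (-1) s)) / 2"
      proof -
        have "\<omega> * phase 1 s = \<omega> * (real k * s) + \<omega> / s ^ k" "\<omega> * phase (-1) s = \<omega> * (real k * s) - \<omega> / s ^ k"
          by (simp_all add: phase_def distrib_left right_diff_distrib)
        then show ?thesis by (simp only: cos_times_cos add.commute)
      qed
      then have "of_real (cos (\<omega> * (real k * s))) * of_real (cos (\<omega> / s ^ k)) =
          complex_of_real ((cos (\<omega> * phase 1 s) + cos (\<omega> * phase (-1) s)) / 2)"
        by (simp only: of_real_mult[symmetric])
      moreover have "(x * of_real p + x * of_real q) / 2 = x * of_real ((p + q) / 2)" for x :: complex and p q :: real
        by (simp add: field_simps)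
      ultimately show ?thesis by (simp only: mult.assoc)
    qed
    ultimately show ?thesis by (simp only: eq integral_unique)
  qed
  note F = filterlim_compose[OF _ filterlim_fst] and S = filterlim_compose[OF _ filterlim_snd]
  have "((\<lambda>x. ((P (snd x) - P (fst x)) + (Q (snd x) - Q (fst x))) / 2) \<longlongrightarrow> ((P1 - P0) + (Q1 - Q0)) / 2)
      (at_right 0 \<times>\<^sub>F at_top)"
    by (intro tendsto_divide tendsto_add tendsto_diff tendsto_const F[OF P(1)] S[OF P(2)] F[OF Q(1)] S[OF Q(2)]) simp
  then show ?thesis
  proof (rule Lim_transform_eventually)
    have "eventually (\<lambda>a. a \<in> {0<..<1::real}) (at_right 0)"
      by (rule eventually_at_rightI[of 0 1]) auto
    from eventually_prodI[OF this eventually_ge_at_top[of "1::real"]]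
    show "\<forall>\<^sub>F x in at_right 0 \<times>\<^sub>F at_top. ((P (snd x) - P (fst x)) + (Q (snd x) - Q (fst x))) / 2 =
        (case x of (a, b) \<Rightarrow> integral {a..b} ?f)"
      by (rule eventually_mono) (simp add: int split_beta)
  qed
qed

text \<open>Both claims rest on \<open>key\<close>, where \<omega> is fixed and \<delta> is free: it
  gives convergence and an error bound for all \<delta> at once. Only afterwards is \<delta> tied to
  \<omega>.\<close>

lemma scaled_integral_asymptotics:
  shows "((\<lambda>\<omega>. of_real (sqrt \<omega>) * scaled_integral \<omega> -
      of_real (sqrt (pi / (2 * real k * (real k + 1))) * cos (\<omega> * (real k + 1) + pi / 4))) \<longlongrightarrow> 0) at_top"
    and scaled_integral_tendsto: "\<omega> > 0 \<Longrightarrow>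
      ((\<lambda>(a, b). integral {a..b} (\<lambda>s. of_real s powr (z - of_nat k) *
        of_real (cos (\<omega> * (real k * s))) * of_real (cos (\<omega> / s ^ k)))) \<longlongrightarrow> scaled_integral \<omega>)
      (at_right 0 \<times>\<^sub>F at_top)"
proof -
  obtain K0 where K0: "K0 \<ge> 0" "\<And>\<omega> Q \<delta>. \<omega> > 0 \<Longrightarrow> primitive 1 \<omega> Q \<Longrightarrow> 0 < \<delta> \<Longrightarrow> \<delta> < 1 \<Longrightarrow>
    \<exists>T. (Q \<longlongrightarrow> T) (at_right 0) \<and> norm (T - Q (1 - \<delta>)) \<le> K0 / (\<omega> * \<delta>)"
    using stationary_tail_0 by blast
  obtain K1 where K1: "K1 \<ge> 0" "\<And>\<omega> Q \<delta>. \<omega> > 0 \<Longrightarrow> primitive 1 \<omega> Q \<Longrightarrow> 0 < \<delta> \<Longrightarrow> \<delta> < 1 \<Longrightarrow>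
    \<exists>T. (Q \<longlongrightarrow> T) at_top \<and> norm (T - Q (1 + \<delta>)) \<le> K1 / (\<omega> * \<delta>)"
    using stationary_tail_top by blast
  obtain K2 where K2: "\<And>\<omega> Q. \<omega> > 0 \<Longrightarrow> primitive (-1) \<omega> Q \<Longrightarrow>
    \<exists>T0 T1. (Q \<longlongrightarrow> T0) (at_right 0) \<and> (Q \<longlongrightarrow> T1) at_top \<and> norm (T1 - T0) \<le> K2 / \<omega>"
    using nonstationary by blast
  define M where "M \<omega> \<delta> = integral {1 - \<delta>..1 + \<delta>}
      (\<lambda>s. cos (\<omega> * (real k + 1) + \<omega> * (real k * (real k + 1) / 2) * (s - 1)\<^sup>2))" for \<omega> \<delta>
  obtain K3 where K3: "K3 \<ge> 0" "\<And>\<omega> Q \<delta>. \<omega> > 0 \<Longrightarrow> primitive 1 \<omega> Q \<Longrightarrow> 0 < \<delta> \<Longrightarrow> \<delta> \<le> 1/2 \<Longrightarrow>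
    norm (Q (1 + \<delta>) - Q (1 - \<delta>) - of_real (M \<omega> \<delta>)) \<le> K3 * (\<delta>\<^sup>2 + \<omega> * \<delta> ^ 4)"
    unfolding M_def using stationary_middle by blast
  have key: "((\<lambda>(a, b). integral {a..b} (\<lambda>s. of_real s powr (z - of_nat k) *
        of_real (cos (\<omega> * (real k * s))) * of_real (cos (\<omega> / s ^ k)))) \<longlongrightarrow> scaled_integral \<omega>)
      (at_right 0 \<times>\<^sub>F at_top) \<and>
      (\<forall>\<delta>. 0 < \<delta> \<longrightarrow> \<delta> \<le> 1/2 \<longrightarrow> norm (scaled_integral \<omega> - of_real (M \<omega> \<delta> / 2)) \<le>
        K2 / \<omega> + (K0 + K1) / (\<omega> * \<delta>) + K3 * (\<delta>\<^sup>2 + \<omega> * \<delta> ^ 4))" if \<omega>: "\<omega> > 0" for \<omega>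
  proof -
    obtain P where P: "primitive 1 \<omega> P" using primitive_exists .
    obtain Q where Q: "primitive (-1) \<omega> Q" using primitive_exists .
    \<comment> \<open>The value 1/2 is an arbitrary admissible \<delta>, used to produce the limits.
      Uniqueness of limits later identifies them with those obtained for any other \<delta>.\<close>
    obtain P0 where P0: "(P \<longlongrightarrow> P0) (at_right 0)" using K0(2)[OF \<omega> P, of "1/2"] by auto
    obtain P1 where P1: "(P \<longlongrightarrow> P1) at_top" using K1(2)[OF \<omega> P, of "1/2"] by auto
    obtain Q0 Q1 where Q01: "(Q \<longlongrightarrow> Q0) (at_right 0)" "(Q \<longlongrightarrow> Q1) at_top" "norm (Q1 - Q0) \<le> K2 / \<omega>"
      using K2[OF \<omega> Q] by auto
    note lim = tendsto_of_primitives[OF P Q P0 P1 Q01(1,2)]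
    have S: "scaled_integral \<omega> = ((P1 - P0) + (Q1 - Q0)) / 2"
      unfolding scaled_integral_def by (rule tendsto_Lim[OF at_right_prod_at_top_neq_bot lim])
    have "norm (scaled_integral \<omega> - of_real (M \<omega> \<delta> / 2)) \<le>
        K2 / \<omega> + (K0 + K1) / (\<omega> * \<delta>) + K3 * (\<delta>\<^sup>2 + \<omega> * \<delta> ^ 4)" if \<delta>: "0 < \<delta>" "\<delta> \<le> 1/2" for \<delta>
    proof -
      obtain P0' where P0': "(P \<longlongrightarrow> P0') (at_right 0)" "norm (P0' - P (1 - \<delta>)) \<le> K0 / (\<omega> * \<delta>)"
        using K0(2)[OF \<omega> P, of \<delta>] \<delta> by auto
      have "P0' = P0" using tendsto_unique[OF _ P0'(1) P0] by simp
      obtain P1' where P1': "(P \<longlongrightarrow> P1') at_top" "norm (P1' - P (1 + \<delta>)) \<le> K1 / (\<omega> * \<delta>)"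
        using K1(2)[OF \<omega> P, of \<delta>] \<delta> by auto
      have "P1' = P1" using tendsto_unique[OF _ P1'(1) P1] by simp
      \<comment> \<open>Tail at infinity, tail at 0 and error of the middle part:
        \<open>P1 - P0\<close> is \<open>u - v + w\<close> plus the model integral
        \<open>M \<omega> \<delta>\<close>.\<close>
      define u v w where "u = P1 - P (1 + \<delta>)" and "v = P0 - P (1 - \<delta>)"
        and "w = P (1 + \<delta>) - P (1 - \<delta>) - of_real (M \<omega> \<delta>)"
      have uvw: "norm u \<le> K1 / (\<omega> * \<delta>)" "norm v \<le> K0 / (\<omega> * \<delta>)" "norm w \<le> K3 * (\<delta>\<^sup>2 + \<omega> * \<delta> ^ 4)"
        using P0'(2) P1'(2) K3(2)[OF \<omega> P \<delta>] \<open>P0' = P0\<close> \<open>P1' = P1\<close> by (simp_all add: u_def v_def w_def)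
      have "scaled_integral \<omega> - of_real (M \<omega> \<delta> / 2) = (u - v + w + (Q1 - Q0)) / 2"
        by (simp add: S u_def v_def w_def field_simps)
      then have "norm (scaled_integral \<omega> - of_real (M \<omega> \<delta> / 2)) = norm (u - v + w + (Q1 - Q0)) / 2"
        by (simp only: norm_divide norm_numeral)
      also have "\<dots> \<le> norm (u - v + w + (Q1 - Q0))" by simp
      also have "\<dots> \<le> norm u + norm v + norm w + norm (Q1 - Q0)"
        using norm_triangle_ineq[of "u - v + w" "Q1 - Q0"] norm_triangle_ineq[of "u - v" w]
          norm_triangle_ineq4[of u v] by linarith
      finally show ?thesis
        using uvw Q01(3) by (simp add: add_divide_distrib)
    qed
    then show ?thesis using lim unfolding S by blast
  qed
  then show "\<omega> > 0 \<Longrightarrow>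
      ((\<lambda>(a, b). integral {a..b} (\<lambda>s. of_real s powr (z - of_nat k) *
        of_real (cos (\<omega> * (real k * s))) * of_real (cos (\<omega> / s ^ k)))) \<longlongrightarrow> scaled_integral \<omega>)
      (at_right 0 \<times>\<^sub>F at_top)" by blast
  define \<delta> where "\<delta> \<omega> = \<omega> powr (- 2 / 5)" for \<omega> :: real
  define \<kappa> where "\<kappa> = real k * (real k + 1) / 2"
  have \<kappa>: "\<kappa> > 0" using k by (simp add: \<kappa>_def)
  \<comment> \<open>The 1/2 stems from the half-sum of cosines; under the root it turns \<kappa>
    into 4 \<kappa> = 2 k (k + 1).\<close>
  have c: "sqrt (pi / (2 * real k * (real k + 1))) = sqrt (pi / \<kappa>) / 2"
  proof -
    have "sqrt (pi / \<kappa>) / 2 = sqrt (pi / \<kappa>) / sqrt 4" by simp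
    also have "\<dots> = sqrt (pi / \<kappa> / 4)" by (simp only: real_sqrt_divide)
    also have "pi / \<kappa> / 4 = pi / (2 * real k * (real k + 1))" by (simp add: \<kappa>_def)
    finally show ?thesis ..
  qed
  have main: "((\<lambda>\<omega>. sqrt \<omega> * M \<omega> (\<delta> \<omega>) - sqrt (pi / \<kappa>) * cos (\<omega> * (real k + 1) + pi / 4)) \<longlongrightarrow> 0) at_top"
    using fresnel_main_term[OF \<kappa>, of "real k + 1"] unfolding M_def \<delta>_def \<kappa>_def .
  have err: "((\<lambda>\<omega>. of_real (sqrt \<omega>) * (scaled_integral \<omega> - of_real (M \<omega> (\<delta> \<omega>) / 2))) \<longlongrightarrow> 0) at_top"
  proof (rule Lim_null_comparison)
    show "((\<lambda>\<omega>. sqrt \<omega> * (K2 / \<omega> + (K0 + K1) / (\<omega> * \<delta> \<omega>) + K3 * ((\<delta> \<omega>)\<^sup>2 + \<omega> * \<delta> \<omega> ^ 4))) \<longlongrightarrow> 0) at_top"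
    proof -
      \<comment> \<open>The exponents of \<omega> are -1/2, then -1/10, then -3/10 and -1/10 for the
        two summands.\<close>
      have "((\<lambda>\<omega>. sqrt \<omega> * (1 / \<omega>)) \<longlongrightarrow> 0) at_top"
        "((\<lambda>\<omega>. sqrt \<omega> * (1 / (\<omega> * \<delta> \<omega>))) \<longlongrightarrow> 0) at_top"
        "((\<lambda>\<omega>. sqrt \<omega> * ((\<delta> \<omega>)\<^sup>2 + \<omega> * \<delta> \<omega> ^ 4)) \<longlongrightarrow> 0) at_top"
        unfolding \<delta>_def by real_asymp+
      then have "((\<lambda>\<omega>. K2 * (sqrt \<omega> * (1 / \<omega>)) + (K0 + K1) * (sqrt \<omega> * (1 / (\<omega> * \<delta> \<omega>))) +
          K3 * (sqrt \<omega> * ((\<delta> \<omega>)\<^sup>2 + \<omega> * \<delta> \<omega> ^ 4))) \<longlongrightarrow> K2 * 0 + (K0 + K1) * 0 + K3 * 0) at_top"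
        by (intro tendsto_add tendsto_mult tendsto_const)
      moreover have "K2 * (r * (1 / x)) + (K0 + K1) * (r * (1 / y)) + K3 * (r * w) =
          r * (K2 / x + (K0 + K1) / y + K3 * w)" for r x y w
        by (simp add: algebra_simps)
      ultimately show ?thesis by (simp only: mult_zero_right add_0_right)
    qed
    have "eventually (\<lambda>\<omega>. \<delta> \<omega> \<le> 1/2) at_top"
      unfolding \<delta>_def by real_asymp
    then show "\<forall>\<^sub>F \<omega> in at_top. norm (of_real (sqrt \<omega>) * (scaled_integral \<omega> - of_real (M \<omega> (\<delta> \<omega>) / 2))) \<le>
        sqrt \<omega> * (K2 / \<omega> + (K0 + K1) / (\<omega> * \<delta> \<omega>) + K3 * ((\<delta> \<omega>)\<^sup>2 + \<omega> * \<delta> \<omega> ^ 4))"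
      using eventually_gt_at_top[of 0]
    proof eventually_elim
      case (elim \<omega>)
      have "\<delta> \<omega> > 0" using elim by (simp add: \<delta>_def)
      then show ?case
        using key[OF elim(2)] elim unfolding norm_mult by (auto intro!: mult_left_mono)
    qed
  qed
  have "((\<lambda>\<omega>. complex_of_real ((sqrt \<omega> * M \<omega> (\<delta> \<omega>) - sqrt (pi / \<kappa>) * cos (\<omega> * (real k + 1) + pi / 4)) / 2)) \<longlongrightarrow> of_real (0 / 2)) at_top"
    by (intro tendsto_of_real tendsto_divide main tendsto_const) simp
  note lim = tendsto_add[OF err this]
  have eq: "of_real r * (x - of_real (m / 2)) + of_real ((r * m - d * t) / 2) =
      of_real r * x - of_real (d / 2 * t)" for r m d t :: real and x :: complex
    by (simp add: right_diff_distrib diff_divide_distrib)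
  show "((\<lambda>\<omega>. of_real (sqrt \<omega>) * scaled_integral \<omega> -
      of_real (sqrt (pi / (2 * real k * (real k + 1))) * cos (\<omega> * (real k + 1) + pi / 4))) \<longlongrightarrow> 0) at_top"
    using lim unfolding c eq by simp
qed

end

section \<open>Reduction to the scaled integral\<close>

text \<open>The logarithm of the frequency \<open>w = (y / k)^(k / (k + 1))\<close>; in these terms \<open>t\<^sub>0\<close> is
  \<open>exp (- log_freq k y / k)\<close>.\<close>

definition log_freq :: "nat \<Rightarrow> real \<Rightarrow> real" where
  "log_freq k y = real k / (real k + 1) * ln (y / real k)"

text \<open>Exponentiated, the second claim reads scale_var = (w/2)^(2k+2) for the frequency w. The
  third is the equation y = k t_0^(-k-1) that makes t_0 the critical point, multiplied by
  t_0.\<close>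

lemma
  assumes "k \<ge> 1" "y > 0"
  shows scale_var_pos: "scale_var k y > 0"
    and ln_scale_var: "ln (scale_var k y) = 2 * (real k + 1) * (log_freq k y - ln 2)"
    and mult_exp_log_freq: "y * exp (- log_freq k y / real k) = real k * exp (log_freq k y)"
proof -
  have k: "real k > 0" using assms(1) by simp
  show "scale_var k y > 0" using assms by (simp add: scale_var_def)
  have lnr: "(real k + 1) * log_freq k y = real k * ln (y / real k)"
    by (simp add: log_freq_def)
  have "ln (scale_var k y) = ln (1 / 4) + real (2 * k) * ln (y / (2 * real k))"
    unfolding scale_var_def using assms by (subst ln_mult) (auto simp: ln_realpow)
  also have "ln (y / (2 * real k)) = ln (y / real k) - ln 2"
    using assms k by (simp add: ln_div ln_mult)
  also have "ln (1 / 4 :: real) = - 2 * ln 2"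
    using ln_realpow[of 2 2] by (simp add: ln_div)
  finally have ln_expand: "ln (scale_var k y) = - 2 * ln 2 + real (2 * k) * (ln (y / real k) - ln 2)" .
  show "ln (scale_var k y) = 2 * (real k + 1) * (log_freq k y - ln 2)"
  proof -
    have "2 * (x + 1) * (u - v) = - 2 * v + 2 * ((x + 1) * u - x * v)" for x u v :: real
      by (simp add: algebra_simps)
    then show ?thesis
      using ln_expand lnr by (simp add: right_diff_distrib)
  qed
  have "ln (y / real k) = real k * ln (y / real k) / real k" using k by simp
  also have "\<dots> = (real k + 1) * log_freq k y / real k" by (simp only: lnr)
  finally have e: "log_freq k y = ln (y / real k) + - log_freq k y / real k"
    using k by (simp add: field_simps)
  have "exp (log_freq k y) = exp (ln (y / real k)) * exp (- log_freq k y / real k)"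
    by (subst e) (rule exp_add)
  also have "exp (ln (y / real k)) = y / real k" using assms k by simp
  finally show "y * exp (- log_freq k y / real k) = real k * exp (log_freq k y)"
    using k by simp
qed

text \<open>The root of \<open>scale_var\<close> is w/2, so the oscillating part of the phase is w
  times k + 1, the value of the phase function at its critical point 1.\<close>

lemma H_phase_eq:
  assumes "k \<ge> 1" "y > 0"
  shows "H_phase k y = exp (log_freq k y) * (real k + 1) + pi / 4"
proof -
  have "scale_var k y powr (1 / (2 * real k + 2)) = exp (1 / (2 * real k + 2) * ln (scale_var k y))"
    using scale_var_pos[OF assms] by (simp add: powr_def)
  also have "1 / (2 * real k + 2) * ln (scale_var k y) = log_freq k y - ln 2"
  proof -
    have "2 * (real k + 1) = 2 * real k + 2" by simp
    moreover have "2 * real k + 2 \<noteq> 0" by linarith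
    ultimately show ?thesis unfolding ln_scale_var[OF assms] by simp
  qed
  also have "exp (log_freq k y - ln 2) = exp (log_freq k y) / 2" by (simp add: exp_diff)
  finally show ?thesis by (simp add: H_phase_def algebra_simps)
qed

text \<open>An exact identity, so the relative error of \<open>H\<close> is that of the scaled
  integral up to a constant factor. All powers are written as exponentials of multiples of real
  logarithms, which turns the claim into a comparison of exponents.\<close>

lemma H_amplitude_eq:
  assumes "k \<ge> 1" "y > 0"
  defines "L \<equiv> log_freq k y"
  shows "H_amplitude k z y * of_real (sqrt (exp L)) =
    of_real (sqrt (pi / (2 * real k * (real k + 1)))) *
      (of_real (exp (- L / real k)) * of_real (exp (- L / real k)) powr (z - of_nat k))"
proof -
  have k: "complex_of_nat k \<noteq> 0" "complex_of_nat k + 1 \<noteq> 0"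
    using assms(1) of_nat_neq_0[of k, where ?'a = complex] by (simp_all add: add.commute)
  define l where "l = complex_of_real L"
  define c where "c = complex_of_real (ln 2)"
  have 1: "of_real (scale_var k y) powr (1 / (4 * (of_nat k + 1)) - (1 + z) / (2 * of_nat k * (of_nat k + 1))) =
      exp ((1 / 2 - (1 + z) / of_nat k) * (l - c))"
  proof -
    have cancel: "1 / (4 * m) * (2 * m) = 1 / 2" "u / (2 * v * m) * (2 * m) = u / v" if "m \<noteq> 0" for m u v :: complex
      using that by simp_all
    have "of_real (ln (scale_var k y)) = 2 * (complex_of_nat k + 1) * (l - c)"
      unfolding ln_scale_var[OF assms(1,2)] by (simp add: l_def c_def L_def)
    then have "(1 / (4 * (of_nat k + 1)) - (1 + z) / (2 * of_nat k * (of_nat k + 1))) * of_real (ln (scale_var k y)) =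
        (1 / (4 * (of_nat k + 1)) * (2 * (of_nat k + 1)) -
         (1 + z) / (2 * of_nat k * (of_nat k + 1)) * (2 * (of_nat k + 1))) * (l - c)"
      by (simp only: mult.assoc[symmetric] left_diff_distrib)
    also have "1 / (4 * (of_nat k + 1)) * (2 * (of_nat k + 1)) = (1 / 2 :: complex)"
      by (rule cancel(1)[OF k(2)])
    also have "(1 + z) / (2 * of_nat k * (of_nat k + 1)) * (2 * (of_nat k + 1)) = (1 + z) / of_nat k"
      by (rule cancel(2)[OF k(2)])
    finally show ?thesis
      unfolding exp_of_real_mult_ln[OF scale_var_pos[OF assms(1,2)]] by simp
  qed
  have 2: "2 powr ((1 + z) / of_nat k) = exp ((1 + z) / of_nat k * c)"
    using exp_of_real_mult_ln[of 2] by (simp add: c_def)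
  have 3: "complex_of_real (sqrt (exp L)) = exp (l / 2)"
  proof -
    have "sqrt (exp L) = exp (L / 2)"
      by (rule real_sqrt_unique) (simp_all add: exp_double[symmetric])
    then show ?thesis by (simp add: l_def flip: exp_of_real)
  qed
  have 4: "complex_of_real (exp (- L / real k)) * of_real (exp (- L / real k)) powr (z - of_nat k) =
      exp (l - (1 + z) / of_nat k * l)"
  proof -
    have "complex_of_real (exp (- L / real k)) = exp (- l / of_nat k)"
      by (simp add: l_def flip: exp_of_real)
    moreover have "complex_of_real (exp (- L / real k)) powr (z - of_nat k) = exp ((z - of_nat k) * (- l / of_nat k))"
      by (subst exp_of_real_mult_ln) (simp_all add: l_def)
    ultimately have "complex_of_real (exp (- L / real k)) * of_real (exp (- L / real k)) powr (z - of_nat k) =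
        exp (- l / of_nat k + (z - of_nat k) * (- l / of_nat k))"
      by (simp only: exp_add)
    also have "- l / of_nat k + (z - of_nat k) * (- l / of_nat k) = l - (1 + z) / of_nat k * l"
      using k by (simp add: field_simps)
    finally show ?thesis .
  qed
  have 5: "sqrt (pi / (2 * real k * (real k + 1))) = sqrt pi / sqrt (real k * (real k + 1)) * exp (- ln 2 / 2)"
  proof -
    have "(exp (ln 2 / 2))\<^sup>2 = (2 :: real)"
      using exp_double[of "ln 2 / 2 :: real"] by simp
    then have "sqrt 2 = exp (ln 2 / 2)"
      by (rule real_sqrt_unique) simp
    moreover have "exp (- ln 2 / 2) = 1 / exp (ln 2 / 2 :: real)"
      by (simp add: exp_minus inverse_eq_divide)
    ultimately have "exp (- ln 2 / 2) = 1 / sqrt 2" by (simp only:)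
    moreover have "sqrt (pi / (2 * real k * (real k + 1))) = sqrt pi / (sqrt 2 * sqrt (real k * (real k + 1)))"
      by (simp only: real_sqrt_divide real_sqrt_mult mult.assoc)
    moreover have "p / (s * q) = p / q * (1 / s)" for p q s :: real
      by simp
    ultimately show ?thesis by (simp only:)
  qed
  have 6: "complex_of_real (exp (- ln 2 / 2)) = exp (- c / 2)"
    by (simp add: c_def flip: exp_of_real)
  \<comment> \<open>The powers of 2 depending on z cancel and leave 1/sqrt 2, the factor by which
    sqrt (2 k (k + 1)) differs from the root in the amplitude.\<close>
  have "exp ((1 / 2 - (1 + z) / of_nat k) * (l - c)) / exp ((1 + z) / of_nat k * c) * exp (l / 2) =
      exp (- c / 2) * exp (l - (1 + z) / of_nat k * l)"
  proof -
    have "(1 / 2 - w) * (l - c) - w * c + l / 2 = - c / 2 + (l - w * l)" for w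
      by (simp add: field_simps)
    from arg_cong[OF this, of exp] show ?thesis
      by (simp only: exp_diff exp_add)
  qed
  moreover have "p * e1 / (q * e2) * e3 = p / q * (e1 / e2 * e3)" for p q e1 e2 e3 :: complex
    by simp
  ultimately show ?thesis
    unfolding H_amplitude_def 1 2 3 4 5 of_real_mult of_real_divide 6
    by (simp only: mult.assoc)
qed

text \<open>At the scale of the critical point both cosines carry the same large parameter, as y t =
  k \<omega> and 1/t^k = \<omega>. The substitution is made in proper integrals, where it is
  unconditional.\<close>

lemma H_eq_scaled_integral:
  assumes "k \<ge> 1" "-1 < Re z" "Re z < real k" "y > 0"
  defines "\<omega> \<equiv> exp (log_freq k y)" and "t \<equiv> exp (- log_freq k y / real k)"
  shows "H k z y = of_real t * of_real t powr (z - of_nat k) * scaled_integrand.scaled_integral k z \<omega>"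
proof -
  interpret scaled_integrand k z
    using assms by unfold_locales auto
  let ?f = "\<lambda>s. of_real s powr (z - of_nat k) * of_real (cos (\<omega> * (real k * s))) * of_real (cos (\<omega> / s ^ k))"
  have t: "t > 0" and \<omega>: "\<omega> > 0" by (simp_all add: t_def \<omega>_def)
  have tk: "t ^ k = 1 / \<omega>"
  proof -
    have "t ^ k = exp (real k * (- log_freq k y / real k))"
      unfolding t_def by (rule exp_of_nat_mult[symmetric])
    also have "real k * (- log_freq k y / real k) = - log_freq k y"
      using assms(1) by simp
    finally show ?thesis by (simp add: \<omega>_def exp_minus divide_inverse)
  qed
  have yt: "y * t = \<omega> * real k"
    using mult_exp_log_freq[OF assms(1,4)] by (simp add: t_def \<omega>_def)
  have H_scale: "H_integrand k z y (t * s) = of_real t powr (z - of_nat k) * ?f s" if "s > 0" for s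
  proof -
    have "y * (t * s) = \<omega> * (real k * s)" using yt by (simp flip: mult.assoc)
    moreover have "1 / (t * s) ^ k = \<omega> / s ^ k" by (simp add: power_mult_distrib tk)
    moreover have "complex_of_real (t * s) powr (z - of_nat k) =
        of_real t powr (z - of_nat k) * of_real s powr (z - of_nat k)"
      unfolding of_real_mult by (rule powr_times_real) (use t that in auto)
    ultimately show ?thesis by (simp only: H_integrand_def mult.assoc)
  qed
  have int: "integral {a..b} (H_integrand k z y) =
      of_real t * of_real t powr (z - of_nat k) * integral {a / t..b / t} ?f" if "a > 0" for a b
  proof -
    have "isCont (H_integrand k z y) s" if "s > 0" for s
    proof -
      have "isCont (\<lambda>s. complex_of_real s powr (z - of_nat k)) s"
        using has_vector_derivative_of_real_powr[OF that] by (rule has_vector_derivative_continuous)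
      moreover have "isCont (\<lambda>s. complex_of_real (cos (y * s))) s"
        by (intro continuous_intros)
      moreover have "isCont (\<lambda>s. complex_of_real (cos (1 / s ^ k))) s"
        using that by (intro continuous_intros) auto
      ultimately show ?thesis unfolding H_integrand_def[abs_def] by (intro isCont_mult)
    qed
    then have "H_integrand k z y integrable_on {a..b}"
      using that by (intro integrable_continuous_interval continuous_at_imp_continuous_on) auto
    from integral_scale_real[OF t this]
    have "integral {a..b} (H_integrand k z y) = t *\<^sub>R integral {a / t..b / t} (\<lambda>s. H_integrand k z y (t * s))" .
    also have "integral {a / t..b / t} (\<lambda>s. H_integrand k z y (t * s)) =
        integral {a / t..b / t} (\<lambda>s. of_real t powr (z - of_nat k) * ?f s)"
    proof (rule Henstock_Kurzweil_Integration.integral_cong)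
      fix s assume "s \<in> {a / t..b / t}"
      moreover have "a / t > 0" using that t by simp
      ultimately have "s > 0" by auto
      then show "H_integrand k z y (t * s) = of_real t powr (z - of_nat k) * ?f s" by (rule H_scale)
    qed
    finally show ?thesis by (simp add: scaleR_conv_of_real mult.assoc)
  qed
  \<comment> \<open>Dividing both endpoints by a fixed positive number respects the two-sided limit,
    so the substitution passes to it.\<close>
  have "filterlim (\<lambda>x. (fst x / t, snd x / t)) (at_right 0 \<times>\<^sub>F at_top) (at_right 0 \<times>\<^sub>F at_top)"
  proof (rule filterlim_Pair)
    have "filterlim (\<lambda>a. a / t) (at_right 0) (at_right 0)" using t by real_asymp
    then show "filterlim (\<lambda>x. fst x / t) (at_right 0) (at_right 0 \<times>\<^sub>F at_top)"
      by (rule filterlim_compose[OF _ filterlim_fst])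
    have "filterlim (\<lambda>b. b / t) at_top at_top" using t by real_asymp
    then show "filterlim (\<lambda>x. snd x / t) at_top (at_right 0 \<times>\<^sub>F at_top)"
      by (rule filterlim_compose[OF _ filterlim_snd])
  qed
  from tendsto_mult[OF tendsto_const filterlim_compose[OF scaled_integral_tendsto[OF \<omega>] this]]
  have "((\<lambda>x. of_real t * of_real t powr (z - of_nat k) * integral {fst x / t..snd x / t} ?f) \<longlongrightarrow>
      of_real t * of_real t powr (z - of_nat k) * scaled_integral \<omega>) (at_right 0 \<times>\<^sub>F at_top)"
    by (simp only: prod.case)
  then have "((\<lambda>(a, b). integral {a..b} (H_integrand k z y)) \<longlongrightarrow>
      of_real t * of_real t powr (z - of_nat k) * scaled_integral \<omega>) (at_right 0 \<times>\<^sub>F at_top)"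
  proof (rule Lim_transform_eventually)
    from eventually_prodI[OF eventually_at_right_less[of "0::real"] eventually_ge_at_top[of "1::real"]]
    show "\<forall>\<^sub>F x in at_right 0 \<times>\<^sub>F at_top. of_real t * of_real t powr (z - of_nat k) *
        integral {fst x / t..snd x / t} ?f = (case x of (a, b) \<Rightarrow> integral {a..b} (H_integrand k z y))"
      by (rule eventually_mono) (simp add: int split_beta)
  qed
  then show ?thesis
    unfolding H_def by (rule tendsto_Lim[OF at_right_prod_at_top_neq_bot])
qed

(* Asymptotics with an oscillating main term A * cos \<theta> are understood in the usual sense
   H = A * (cos \<theta> + o(1)).  Convergence of the quotient to 1 (asymp_equiv) is not meant and
   fails in general, because the main term has arbitrarily large zeros: for k = 1, z = 0 one has
   H(y) = K_0(2 sqrt y) - (pi/2) Y_0(2 sqrt y), which is nonzero at all large zeros of the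
   main term. *)

theorem theorem4p8:
  fixes k :: nat and z :: complex
  assumes "k \<ge> 1" and "-1 < Re z" and "Re z < real k"
  shows "(\<lambda>y. H k z y - H_amplitude k z y * of_real (cos (H_phase k y)))
           \<in> o[at_top](H_amplitude k z)"
proof (rule smalloI_tendsto)
  interpret scaled_integrand k z
    using assms by unfold_locales auto
  define c where "c = sqrt (pi / (2 * real k * (real k + 1)))"
  have c: "c > 0" using assms(1) by (simp add: c_def)
  \<comment> \<open>The right-hand side of \<open>H_amplitude_eq\<close> is a product of nonzero
    factors.\<close>
  have A: "H_amplitude k z y \<noteq> 0" if "y > 0" for y
    using H_amplitude_eq[OF assms(1) that, of z] assms(1) by auto
  then show "\<forall>\<^sub>F y in at_top. H_amplitude k z y \<noteq> 0"
    by (rule eventually_mono[OF eventually_gt_at_top[of 0]])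
  define D where "D \<omega> = of_real (sqrt \<omega>) * scaled_integral \<omega> -
      of_real (c * cos (\<omega> * (real k + 1) + pi / 4))" for \<omega>
  have "filterlim (\<lambda>y. exp (log_freq k y)) at_top at_top"
  proof -
    define a b where "a = real k / (real k + 1)" and "b = real k"
    have "a > 0" "b > 0" using assms(1) by (simp_all add: a_def b_def)
    then have "filterlim (\<lambda>y. exp (a * ln (y / b))) at_top at_top" by real_asymp
    then show ?thesis by (simp add: log_freq_def a_def b_def)
  qed
  from filterlim_compose[OF scaled_integral_asymptotics(1)[folded c_def] this]
  have "((\<lambda>y. D (exp (log_freq k y))) \<longlongrightarrow> 0) at_top"
    unfolding D_def .
  from tendsto_divide[OF this tendsto_const[of "of_real c"]] c
  have "((\<lambda>y. D (exp (log_freq k y)) / of_real c) \<longlongrightarrow> 0) at_top" by simp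
  then show "((\<lambda>y. (H k z y - H_amplitude k z y * of_real (cos (H_phase k y))) / H_amplitude k z y) \<longlongrightarrow> 0) at_top"
  proof (rule Lim_transform_eventually)
    \<comment> \<open>An exact equality for positive y: with \<open>H k z y = T * S\<close> and
      \<open>A * r = of_real c * T\<close>, dividing by \<open>A\<close> leaves
      \<open>r * S / of_real c\<close>, and the power \<open>T\<close> drops out.\<close>
    show "\<forall>\<^sub>F y in at_top. D (exp (log_freq k y)) / of_real c =
        (H k z y - H_amplitude k z y * of_real (cos (H_phase k y))) / H_amplitude k z y"
      using eventually_gt_at_top[of 0]
    proof eventually_elim
      case (elim y)
      define \<omega> where "\<omega> = exp (log_freq k y)"
      define A where "A = H_amplitude k z y"
      define S where "S = scaled_integral \<omega>"
      define r where "r = complex_of_real (sqrt \<omega>)"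
      have nz: "A \<noteq> 0" "complex_of_real c \<noteq> 0" using A[OF elim] c by (auto simp: A_def)
      define T where "T = of_real (exp (- log_freq k y / real k)) *
        complex_of_real (exp (- log_freq k y / real k)) powr (z - of_nat k)"
      have "H k z y = T * S"
        unfolding T_def S_def \<omega>_def by (rule H_eq_scaled_integral[OF assms elim])
      moreover have "A * r = of_real c * T"
        unfolding T_def A_def r_def \<omega>_def c_def by (rule H_amplitude_eq[OF assms(1) elim])
      ultimately have H: "H k z y = A * r * S / of_real c"
        using nz by simp
      have cancel: "(r * S - of_real (c * u)) / of_real c = (A * r * S / of_real c - A * of_real u) / A" for u
        using nz by (simp add: diff_divide_distrib)
      show ?case
        unfolding D_def H H_phase_eq[OF assms(1) elim] A_def[symmetric] \<omega>_def[symmetric] S_def[symmetric] r_def[symmetric]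
        by (rule cancel)
    qed
  qed
qed

end
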